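(* Let $(M^n,g)$ be a smooth Riemannian manifold, $e_1,\dots,e_n$ a local orthonormal frame with dual coframe $\omega^1,\dots,\omega^n$, Levi-Civita connection forms $\omega^i_j$ and curvature components $R_{ijkl}$. The Killing equation $L_Xg=0$ for an infinitesimal isometry $X=\xi^je_j$ admits a completely determined prolongation to second order, given by the vanishing of the following system of $1$-forms $\{\theta^i,\theta^i_j\}$ defined on the bundle $J^1(TM)\to M$ of $1$-jets of vector fields (with fiber coordinates $\xi^i,\xi^i_j$): $$\theta^i=d\xi^i+\xi^k\,\omega^i_k-\xi^i_k\,\omega^k\quad\text{with}\quad \xi^j_k+\xi^k_j=0,$$ $$\theta^i_j=d\xi^i_j-\xi^i_k\,\omega^k_j+\xi^k_j\,\omega^i_k+\xi^kR_{ijkl}\,\omega^l .$$ That is, if $X=\xi^je_j$ satisfies $L_Xg=0$ and the functions $\xi^i_k$ are defined by $d\xi^i+\xi^k\omega^i_k=\xi^i_k\omega^k$ (so that $\theta^i=0$), then $\xi^j_k+\xi^k_j=0$ and $\theta^i_j=0$ for all $i,j,k$.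
   Context: Repeated indices are summed from $1$ to $n$. $L$ denotes the Lie derivative. An infinitesimal isometry (Killing field) is a smooth vector field $X$ with $L_Xg=0$. The forms $\omega^i_j$ and the functions $R_{ijkl}$ (components of the curvature tensor, with all indices lowered since the frame is orthonormal) are determined by $$d\omega^i=\omega^k\wedge\omega^i_k,\qquad d\omega^i_j=\omega^k_j\wedge\omega^i_k+\tfrac12R_{ijkl}\,\omega^k\wedge\omega^l,\qquad \omega^i_j+\omega^j_i=0,$$ with $R_{ijkl}=-R_{ijlk}$. A completely determined prolongation to second order of a first-order linear PDE system for unknown functions $u=(u^\alpha)$ is a system, obtained by differentiating the given equations, that expresses all second-order partial derivatives of $u$ as linear combinations (with smooth coefficients) of $u$ and its first-order partial derivatives. It is encoded by $1$-forms on the first jet space: one set of forms whose vanishing says that the fiber coordinates of the jet are the first derivatives of $u$, and a second set whose vanishing gives the differentials of the first derivatives in terms of the $1$-jet. *)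

theory Defs
  imports "HOL-Analysis.Analysis"
begin

section \<open>Smooth manifolds\<close>

primrec Ck_on :: "nat \<Rightarrow> 'v::real_normed_vector set \<Rightarrow> ('v \<Rightarrow> 'w::real_normed_vector) \<Rightarrow> bool" where
  "Ck_on 0 S f \<longleftrightarrow> continuous_on S f"
| "Ck_on (Suc k) S f \<longleftrightarrow> (\<forall>x\<in>S. f differentiable (at x)) \<and>
     (\<forall>v. Ck_on k S (\<lambda>x. frechet_derivative f (at x) v))"

definition smooth_on :: "'v::real_normed_vector set \<Rightarrow> ('v \<Rightarrow> 'w::real_normed_vector) \<Rightarrow> bool" where
  "smooth_on S f \<longleftrightarrow> (\<forall>k. Ck_on k S f)"

text \<open>A chart is a pair of its domain and its coordinate map. A manifold is a topology \<^term>\<open>T\<close>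
  (its points are \<^term>\<open>topspace T\<close>) together with a smooth atlas \<^term>\<open>A\<close>, which need not be maximal.
  Its dimension is the cardinality of the index type \<^typ>\<open>'n\<close>.\<close>

type_synonym ('a, 'n) chart = "'a set \<times> ('a \<Rightarrow> real ^ 'n)"

definition is_chart :: "'a topology \<Rightarrow> ('a, 'n::finite) chart \<Rightarrow> bool" where
  "is_chart T c \<longleftrightarrow> (case c of (D, \<phi>) \<Rightarrow> openin T D \<and> open (\<phi> ` D) \<and>
     homeomorphic_map (subtopology T D) (top_of_set (\<phi> ` D)) \<phi>)"

definition smooth_manifold :: "'a topology \<Rightarrow> ('a, 'n::finite) chart set \<Rightarrow> bool" where
  "smooth_manifold T A \<longleftrightarrow> Hausdorff_space T \<and> second_countable T \<and>
     (\<forall>c\<in>A. is_chart T c) \<and> (\<Union>(D, \<phi>)\<in>A. D) = topspace T \<and>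
     (\<forall>(D, \<phi>)\<in>A. \<forall>(E, \<psi>)\<in>A. smooth_on (\<phi> ` (D \<inter> E)) (\<psi> \<circ> inv_into D \<phi>))"

definition smooth_fun :: "('a, 'n::finite) chart set \<Rightarrow> 'a set \<Rightarrow> ('a \<Rightarrow> real) \<Rightarrow> bool" where
  "smooth_fun A V f \<longleftrightarrow> (\<forall>(D, \<phi>)\<in>A. smooth_on (\<phi> ` (D \<inter> V)) (f \<circ> inv_into D \<phi>))"

definition smooth_near :: "'a topology \<Rightarrow> ('a, 'n::finite) chart set \<Rightarrow> 'a \<Rightarrow> ('a \<Rightarrow> real) \<Rightarrow> bool" where
  "smooth_near T A p f \<longleftrightarrow> (\<exists>V. openin T V \<and> p \<in> V \<and> smooth_fun A V f)"

section \<open>Tangent vectors, vector fields and forms\<close>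

text \<open>Tangent vectors at \<^term>\<open>p\<close> are derivations of the germs at \<^term>\<open>p\<close> of smooth functions. They take the
  value 0 on functions that are not smooth near \<^term>\<open>p\<close>, so that equality of tangent vectors is equality of
  functionals.\<close>

type_synonym 'a functional = "('a \<Rightarrow> real) \<Rightarrow> real"
type_synonym 'a vfield = "'a \<Rightarrow> 'a functional"
type_synonym 'a form1 = "'a \<Rightarrow> 'a functional \<Rightarrow> real"

definition tangent_space :: "'a topology \<Rightarrow> ('a, 'n::finite) chart set \<Rightarrow> 'a \<Rightarrow> 'a functional set" where
  "tangent_space T A p = {v.
     (\<forall>f. \<not> smooth_near T A p f \<longrightarrow> v f = 0) \<and>
     (\<forall>f g V. openin T V \<and> p \<in> V \<and> (\<forall>q\<in>V. f q = g q) \<longrightarrow> v f = v g) \<and>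
     (\<forall>f g c. smooth_near T A p f \<and> smooth_near T A p g \<longrightarrow>
        v (\<lambda>q. c * f q) = c * v f \<and>
        v (\<lambda>q. f q + g q) = v f + v g \<and>
        v (\<lambda>q. f q * g q) = v f * g p + f p * v g)}"

text \<open>Only the values on \<^term>\<open>V\<close> of a vector field on \<^term>\<open>V\<close> matter.\<close>

definition vector_field :: "'a topology \<Rightarrow> ('a, 'n::finite) chart set \<Rightarrow> 'a set \<Rightarrow> 'a vfield \<Rightarrow> bool" where
  "vector_field T A V X \<longleftrightarrow> (\<forall>p\<in>V. X p \<in> tangent_space T A p) \<and>
     (\<forall>V' f. openin T V' \<and> V' \<subseteq> V \<and> smooth_fun A V' f \<longrightarrow> smooth_fun A V' (\<lambda>p. X p f))"

definition bracket :: "'a topology \<Rightarrow> ('a, 'n::finite) chart set \<Rightarrow> 'a vfield \<Rightarrow> 'a vfield \<Rightarrow> 'a vfield" where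
  "bracket T A X Y p = (\<lambda>f. if smooth_near T A p f
     then X p (\<lambda>q. Y q f) - Y p (\<lambda>q. X q f) else 0)"

definition linear_at :: "'a topology \<Rightarrow> ('a, 'n::finite) chart set \<Rightarrow> 'a \<Rightarrow> ('a functional \<Rightarrow> real) \<Rightarrow> bool" where
  "linear_at T A p \<alpha> \<longleftrightarrow> (\<forall>u\<in>tangent_space T A p. \<forall>v\<in>tangent_space T A p. \<forall>a b.
     \<alpha> (\<lambda>f. a * u f + b * v f) = a * \<alpha> u + b * \<alpha> v)"

definition one_form :: "'a topology \<Rightarrow> ('a, 'n::finite) chart set \<Rightarrow> 'a set \<Rightarrow> 'a form1 \<Rightarrow> bool" where
  "one_form T A V \<alpha> \<longleftrightarrow> (\<forall>p\<in>V. linear_at T A p (\<alpha> p)) \<and>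
     (\<forall>V' Y. openin T V' \<and> V' \<subseteq> V \<and> vector_field T A V' Y \<longrightarrow> smooth_fun A V' (\<lambda>p. \<alpha> p (Y p)))"

definition wedge :: "'a form1 \<Rightarrow> 'a form1 \<Rightarrow> 'a vfield \<Rightarrow> 'a vfield \<Rightarrow> 'a \<Rightarrow> real" where
  "wedge \<alpha> \<beta> Y Z p = \<alpha> p (Y p) * \<beta> p (Z p) - \<alpha> p (Z p) * \<beta> p (Y p)"

definition ext_d :: "'a topology \<Rightarrow> ('a, 'n::finite) chart set \<Rightarrow> 'a form1 \<Rightarrow> 'a vfield \<Rightarrow> 'a vfield \<Rightarrow> 'a \<Rightarrow> real" where
  "ext_d T A \<alpha> Y Z p =
     Y p (\<lambda>q. \<alpha> q (Z q)) - Z p (\<lambda>q. \<alpha> q (Y q)) - \<alpha> p (bracket T A Y Z p)"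

section \<open>Riemannian metrics, orthonormal frames, connection forms\<close>

definition riemannian_metric ::
  "'a topology \<Rightarrow> ('a, 'n::finite) chart set \<Rightarrow> ('a \<Rightarrow> 'a functional \<Rightarrow> 'a functional \<Rightarrow> real) \<Rightarrow> bool" where
  "riemannian_metric T A g \<longleftrightarrow>
     (\<forall>p\<in>topspace T. \<forall>u\<in>tangent_space T A p.
        linear_at T A p (g p u) \<and>
        (\<forall>v\<in>tangent_space T A p. g p u v = g p v u) \<and>
        (u \<noteq> (\<lambda>f. 0) \<longrightarrow> g p u u > 0)) \<and>
     (\<forall>V Y Z. openin T V \<and> vector_field T A V Y \<and> vector_field T A V Z \<longrightarrow>
        smooth_fun A V (\<lambda>p. g p (Y p) (Z p)))"

definition orthonormal_frame ::
  "'a topology \<Rightarrow> ('a, 'n::finite) chart set \<Rightarrow> ('a \<Rightarrow> 'a functional \<Rightarrow> 'a functional \<Rightarrow> real) \<Rightarrow>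
   'a set \<Rightarrow> ('n \<Rightarrow> 'a vfield) \<Rightarrow> bool" where
  "orthonormal_frame T A g U e \<longleftrightarrow> (\<forall>i. vector_field T A U (e i)) \<and>
     (\<forall>p\<in>U. (\<forall>v\<in>tangent_space T A p. \<exists>!c. v = (\<lambda>f. \<Sum>i\<in>UNIV. c i * e i p f)) \<and>
             (\<forall>i j. g p (e i p) (e j p) = (if i = j then 1 else 0)))"

definition dual_coframe ::
  "'a topology \<Rightarrow> ('a, 'n::finite) chart set \<Rightarrow> 'a set \<Rightarrow> ('n \<Rightarrow> 'a vfield) \<Rightarrow> ('n \<Rightarrow> 'a form1) \<Rightarrow> bool" where
  "dual_coframe T A U e \<omega> \<longleftrightarrow> (\<forall>i. one_form T A U (\<omega> i)) \<and>
     (\<forall>p\<in>U. \<forall>i j. \<omega> i p (e j p) = (if i = j then 1 else 0))"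

text \<open>\<^term>\<open>W i j\<close> is the form \<open>\<omega>\<^sup>i\<^sub>j\<close>. Identities of 2-forms on \<^term>\<open>U\<close> are stated by evaluating both
  sides on local vector fields.\<close>

definition connection_curvature ::
  "'a topology \<Rightarrow> ('a, 'n::finite) chart set \<Rightarrow> 'a set \<Rightarrow> ('n \<Rightarrow> 'a form1) \<Rightarrow>
   ('n \<Rightarrow> 'n \<Rightarrow> 'a form1) \<Rightarrow> ('n \<Rightarrow> 'n \<Rightarrow> 'n \<Rightarrow> 'n \<Rightarrow> 'a \<Rightarrow> real) \<Rightarrow> bool" where
  "connection_curvature T A U \<omega> W R \<longleftrightarrow>
     (\<forall>i j. one_form T A U (W i j)) \<and>
     (\<forall>i j k l. smooth_fun A U (R i j k l)) \<and>
     (\<forall>i j. \<forall>p\<in>U. \<forall>v\<in>tangent_space T A p. W i j p v + W j i p v = 0) \<and>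
     (\<forall>i j k l. \<forall>p\<in>U. R i j k l p = - R i j l k p) \<and>
     (\<forall>V Y Z. openin T V \<and> V \<subseteq> U \<and> vector_field T A V Y \<and> vector_field T A V Z \<longrightarrow>
       (\<forall>p\<in>V.
         (\<forall>i. ext_d T A (\<omega> i) Y Z p = (\<Sum>k\<in>UNIV. wedge (\<omega> k) (W i k) Y Z p)) \<and>
         (\<forall>i j. ext_d T A (W i j) Y Z p = (\<Sum>k\<in>UNIV. wedge (W k j) (W i k) Y Z p) +
            1 / 2 * (\<Sum>k\<in>UNIV. \<Sum>l\<in>UNIV. R i j k l p * wedge (\<omega> k) (\<omega> l) Y Z p))))"

definition lie_derivative_metric ::
  "'a topology \<Rightarrow> ('a, 'n::finite) chart set \<Rightarrow> 'a vfield \<Rightarrow> ('a \<Rightarrow> 'a functional \<Rightarrow> 'a functional \<Rightarrow> real) \<Rightarrow>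
   'a vfield \<Rightarrow> 'a vfield \<Rightarrow> 'a \<Rightarrow> real" where
  "lie_derivative_metric T A X g Y Z p =
     X p (\<lambda>q. g q (Y q) (Z q)) - g p (bracket T A X Y p) (Z p) - g p (Y p) (bracket T A X Z p)"

definition killing_field ::
  "'a topology \<Rightarrow> ('a, 'n::finite) chart set \<Rightarrow> ('a \<Rightarrow> 'a functional \<Rightarrow> 'a functional \<Rightarrow> real) \<Rightarrow>
   'a set \<Rightarrow> 'a vfield \<Rightarrow> bool" where
  "killing_field T A g V X \<longleftrightarrow> vector_field T A V X \<and>
     (\<forall>V' Y Z. openin T V' \<and> V' \<subseteq> V \<and> vector_field T A V' Y \<and> vector_field T A V' Z \<longrightarrow>
        (\<forall>p\<in>V'. lie_derivative_metric T A X g Y Z p = 0))"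

section \<open>The bundle of 1-jets of vector fields\<close>

text \<open>A 1-jet at \<^term>\<open>p\<close> is \<^term>\<open>p\<close> together with a class of local vector fields that agree to first
  order at \<^term>\<open>p\<close>.\<close>

type_synonym 'a jet = "'a \<times> 'a vfield set"

definition local_field :: "'a topology \<Rightarrow> ('a, 'n::finite) chart set \<Rightarrow> 'a \<Rightarrow> 'a vfield \<Rightarrow> bool" where
  "local_field T A p X \<longleftrightarrow> (\<exists>V. openin T V \<and> p \<in> V \<and> vector_field T A V X)"

definition same_jet1 :: "'a topology \<Rightarrow> ('a, 'n::finite) chart set \<Rightarrow> 'a \<Rightarrow> 'a vfield \<Rightarrow> 'a vfield \<Rightarrow> bool" where
  "same_jet1 T A p X Y \<longleftrightarrow> X p = Y p \<and>
     (\<forall>v\<in>tangent_space T A p. \<forall>f. smooth_near T A p f \<longrightarrow> v (\<lambda>q. X q f) = v (\<lambda>q. Y q f))"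

definition jet1 :: "'a topology \<Rightarrow> ('a, 'n::finite) chart set \<Rightarrow> 'a vfield \<Rightarrow> 'a \<Rightarrow> 'a jet" where
  "jet1 T A X p = (p, {Y. local_field T A p Y \<and> same_jet1 T A p X Y})"

definition J1 :: "'a topology \<Rightarrow> ('a, 'n::finite) chart set \<Rightarrow> 'a set \<Rightarrow> 'a jet set" where
  "J1 T A V = {jet1 T A X p | X p. p \<in> V \<and> local_field T A p X}"

text \<open>The fiber coordinates \<open>\<xi>\<^sup>i\<close> and \<open>\<xi>\<^sup>i\<^sub>k\<close> over the domain of the frame. On the jet of
  \<open>Y = \<eta>\<^sup>i e\<^sub>i\<close> they are \<open>\<eta>\<^sup>i\<close> and the coefficient of \<open>\<omega>\<^sup>k\<close> in \<open>d\<eta>\<^sup>i + \<eta>\<^sup>m \<omega>\<^sup>i\<^sub>m\<close>; these do not depend on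
  the representative \<open>Y\<close>.\<close>

definition jet_coord :: "('n::finite \<Rightarrow> 'a form1) \<Rightarrow> 'n \<Rightarrow> 'a jet \<Rightarrow> real" where
  "jet_coord \<omega> i J = (let p = fst J; Y = (SOME Y. Y \<in> snd J) in \<omega> i p (Y p))"

definition jet_coord1 ::
  "('n::finite \<Rightarrow> 'a vfield) \<Rightarrow> ('n \<Rightarrow> 'a form1) \<Rightarrow> ('n \<Rightarrow> 'n \<Rightarrow> 'a form1) \<Rightarrow> 'n \<Rightarrow> 'n \<Rightarrow> 'a jet \<Rightarrow> real" where
  "jet_coord1 e \<omega> W i k J = (let p = fst J; Y = (SOME Y. Y \<in> snd J) in
     e k p (\<lambda>q. \<omega> i q (Y q)) + (\<Sum>m\<in>UNIV. \<omega> m p (Y p) * W i m p (e k p)))"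

definition jet_section ::
  "'a topology \<Rightarrow> ('a, 'n::finite) chart set \<Rightarrow> ('n \<Rightarrow> 'a vfield) \<Rightarrow> ('n \<Rightarrow> 'a form1) \<Rightarrow>
   ('n \<Rightarrow> 'n \<Rightarrow> 'a form1) \<Rightarrow> 'a set \<Rightarrow> ('a \<Rightarrow> 'a jet) \<Rightarrow> bool" where
  "jet_section T A e \<omega> W V s \<longleftrightarrow> (\<forall>p\<in>V. s p \<in> J1 T A V \<and> fst (s p) = p) \<and>
     (\<forall>i. smooth_fun A V (jet_coord \<omega> i \<circ> s)) \<and> (\<forall>i k. smooth_fun A V (jet_coord1 e \<omega> W i k \<circ> s))"

text \<open>Tangent vectors of the jet bundle are derivations of functions on it as well; \<open>d F\<close> sends such a
  vector \<open>w\<close> to \<open>w F\<close>. A form pulls back to \<^term>\<open>V\<close> along a section \<^term>\<open>s\<close> through the push-forward of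
  tangent vectors.\<close>

type_synonym 'a jet_form = "'a jet \<Rightarrow> 'a jet functional \<Rightarrow> real"

definition push_forward :: "('a \<Rightarrow> 'b) \<Rightarrow> 'a functional \<Rightarrow> 'b functional" where
  "push_forward s v = (\<lambda>F. v (F \<circ> s))"

definition vanishes_along ::
  "'a topology \<Rightarrow> ('a, 'n::finite) chart set \<Rightarrow> 'a set \<Rightarrow> ('a \<Rightarrow> 'a jet) \<Rightarrow> 'a jet_form \<Rightarrow> bool" where
  "vanishes_along T A V s \<Theta> \<longleftrightarrow>
     (\<forall>p\<in>V. \<forall>v\<in>tangent_space T A p. \<Theta> (s p) (push_forward s v) = 0)"

text \<open>The form \<open>\<theta>\<^sup>i = d\<xi>\<^sup>i + \<xi>\<^sup>k \<omega>\<^sup>i\<^sub>k - \<xi>\<^sup>i\<^sub>k \<omega>\<^sup>k\<close>; forms on the base are pulled back along the projection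
  \<^const>\<open>fst\<close>.\<close>

definition theta1 ::
  "('n::finite \<Rightarrow> 'a vfield) \<Rightarrow> ('n \<Rightarrow> 'a form1) \<Rightarrow> ('n \<Rightarrow> 'n \<Rightarrow> 'a form1) \<Rightarrow> 'n \<Rightarrow> 'a jet_form" where
  "theta1 e \<omega> W i J w = (let p = fst J; v = push_forward fst w in
     w (jet_coord \<omega> i)
     + (\<Sum>k\<in>UNIV. jet_coord \<omega> k J * W i k p v)
     - (\<Sum>k\<in>UNIV. jet_coord1 e \<omega> W i k J * \<omega> k p v))"

text \<open>The form \<open>\<theta>\<^sup>i\<^sub>j = d\<xi>\<^sup>i\<^sub>j - \<xi>\<^sup>i\<^sub>k \<omega>\<^sup>k\<^sub>j + \<xi>\<^sup>k\<^sub>j \<omega>\<^sup>i\<^sub>k + \<xi>\<^sup>k R\<^sub>i\<^sub>j\<^sub>k\<^sub>l \<omega>\<^sup>l\<close>.\<close>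

definition theta2 ::
  "('n::finite \<Rightarrow> 'a vfield) \<Rightarrow> ('n \<Rightarrow> 'a form1) \<Rightarrow> ('n \<Rightarrow> 'n \<Rightarrow> 'a form1) \<Rightarrow>
   ('n \<Rightarrow> 'n \<Rightarrow> 'n \<Rightarrow> 'n \<Rightarrow> 'a \<Rightarrow> real) \<Rightarrow> 'n \<Rightarrow> 'n \<Rightarrow> 'a jet_form" where
  "theta2 e \<omega> W R i j J w = (let p = fst J; v = push_forward fst w in
     w (jet_coord1 e \<omega> W i j)
     - (\<Sum>k\<in>UNIV. jet_coord1 e \<omega> W i k J * W k j p v)
     + (\<Sum>k\<in>UNIV. jet_coord1 e \<omega> W k j J * W i k p v)
     + (\<Sum>k\<in>UNIV. \<Sum>l\<in>UNIV. jet_coord \<omega> k J * R i j k l p * \<omega> l p v))"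

definition skew_jets ::
  "'a topology \<Rightarrow> ('a, 'n::finite) chart set \<Rightarrow> 'a set \<Rightarrow> ('n \<Rightarrow> 'a vfield) \<Rightarrow> ('n \<Rightarrow> 'a form1) \<Rightarrow>
   ('n \<Rightarrow> 'n \<Rightarrow> 'a form1) \<Rightarrow> 'a jet set" where
  "skew_jets T A U e \<omega> W =
     {J \<in> J1 T A U. \<forall>j k. jet_coord1 e \<omega> W j k J + jet_coord1 e \<omega> W k j J = 0}"

section \<open>Completely determined prolongations\<close>

text \<open>\<^term>\<open>PDE V X\<close> says that \<^term>\<open>X\<close> solves a first-order system on \<^term>\<open>V\<close>; the unknowns are the
  components \<open>\<xi>\<^sup>i = \<omega>\<^sup>i(X)\<close>. The jets in \<^term>\<open>C\<close> are those satisfying the algebraic conditions that the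
  system imposes on 1-jets.

  The three clauses: vanishing of the forms \<^term>\<open>\<Theta> i\<close> says that the first-order coordinates of a
  section are the first derivatives of the zeroth-order ones; a vector field solves the system exactly
  when its 1-jet lies in \<^term>\<open>C\<close> and annihilates the forms \<^term>\<open>\<Theta>' i j\<close>; and the vanishing of these forms
  expresses every second derivative of the unknowns linearly, with smooth coefficients independent of
  the solution, by the unknowns and their first derivatives. In the last clause \<^term>\<open>Y\<close> and \<^term>\<open>Z\<close> may in
  particular be coordinate fields of a chart.\<close>

definition completely_determined_prolongation ::
  "'a topology \<Rightarrow> ('a, 'n::finite) chart set \<Rightarrow> 'a set \<Rightarrow> ('n \<Rightarrow> 'a vfield) \<Rightarrow> ('n \<Rightarrow> 'a form1) \<Rightarrow>
   ('n \<Rightarrow> 'n \<Rightarrow> 'a form1) \<Rightarrow> ('a set \<Rightarrow> 'a vfield \<Rightarrow> bool) \<Rightarrow> 'a jet set \<Rightarrow>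
   ('n \<Rightarrow> 'a jet_form) \<Rightarrow> ('n \<Rightarrow> 'n \<Rightarrow> 'a jet_form) \<Rightarrow> bool" where
  "completely_determined_prolongation T A U e \<omega> W PDE C \<Theta> \<Theta>' \<longleftrightarrow>
     (\<forall>V. openin T V \<and> V \<subseteq> U \<longrightarrow>
       (\<forall>s. jet_section T A e \<omega> W V s \<longrightarrow>
          ((\<forall>i. vanishes_along T A V s (\<Theta> i)) \<longleftrightarrow>
           (\<exists>X. vector_field T A V X \<and> (\<forall>p\<in>V. s p = jet1 T A X p)))) \<and>
       (\<forall>X. vector_field T A V X \<longrightarrow>
          (PDE V X \<longleftrightarrow> (\<forall>p\<in>V. jet1 T A X p \<in> C) \<and>
             (\<forall>i j. vanishes_along T A V (jet1 T A X) (\<Theta>' i j)))) \<and>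
       (\<forall>Y Z. vector_field T A V Y \<and> vector_field T A V Z \<longrightarrow>
          (\<exists>a b. (\<forall>i m. smooth_fun A V (a i m)) \<and> (\<forall>i m r. smooth_fun A V (b i m r)) \<and>
             (\<forall>X. vector_field T A V X \<and> (\<forall>p\<in>V. jet1 T A X p \<in> C) \<and>
                  (\<forall>i j. vanishes_along T A V (jet1 T A X) (\<Theta>' i j)) \<longrightarrow>
                (\<forall>p\<in>V. \<forall>i. Y p (\<lambda>q. Z q (\<lambda>r. \<omega> i r (X r))) =
                   (\<Sum>m\<in>UNIV. a i m p * \<omega> m p (X p)) +
                   (\<Sum>m\<in>UNIV. \<Sum>r\<in>UNIV. b i m r p * e r p (\<lambda>q. \<omega> m q (X q))))))))"

end

theory Submission
  imports Defs
begin

text \<open>Expanding \<open>L\<^sub>X g\<close> in the frame gives \<open>(L\<^sub>X g)(Y, Z) = (\<xi>\<^sup>i\<^sub>k + \<xi>\<^sup>k\<^sub>i) Y\<^sup>k Z\<^sup>i\<close>, so \<open>X\<close> is Killing if and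
  only if the covariant derivative \<open>\<xi>\<^sup>i\<^sub>k\<close> is skew. Write \<open>\<theta>\<^sup>i\<^sub>j = B\<^sub>i\<^sub>j\<^sub>l \<omega>\<^sup>l\<close> along the jet of \<open>X\<close>. If \<open>X\<close> is
  Killing, \<open>B\<close> is skew in \<open>i, j\<close>; the Ricci identity (from \<open>d(d\<xi>\<^sup>i) = 0\<close>) and the first Bianchi identity
  (from the Jacobi identity for the frame) make it symmetric in \<open>j, l\<close>. A tensor with both symmetries
  vanishes.

  All 2-form identities are used only on frame fields, and a tangent vector at a point of the frame
  domain is determined by its frame components, so no coordinate description of the tangent space is
  needed.\<close>

section \<open>Algebra of smooth functions\<close>

text \<open>Since tangent vectors are derivations of germs, \<open>d(d f) = 0\<close> appears as the
  commutation rule for two derivations, i.e. through \<open>bracket\<close>, which must first be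
  shown to be a tangent vector. The derivation rules hold only for smooth germs, and an identity
  between functions \<open>\<lambda>q. Z q f\<close> typically holds only near \<open>p\<close>;
  hence the constant pairing of a \<open>smooth_near\<close> obligation with locality of the outer
  vector.

  The curvature term in \<open>theta2\<close> is what makes \<open>B\<close> symmetric in its last
  two slots: commuting covariant derivatives leaves one curvature term, and the Bianchi identity
  writes it as a difference of two terms of the kind occurring in \<open>B\<close>.

  The last clause of the prolongation asks for coefficients fixed before the solution is chosen.
  Solving for the second derivatives of one field at a time does not give this, so
  \<open>jet_linear\<close> treats operators on a whole set of solutions, with common coefficients,
  and is closed under the operations that occur.\<close>

lemma Ck_on_cong:
  assumes "open S" "\<And>x. x \<in> S \<Longrightarrow> f x = g x" "Ck_on k S f"
  shows "Ck_on k S g"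
  using assms(2,3)
proof (induction k arbitrary: f g)
  case 0
  then show ?case by (simp cong: continuous_on_cong)
next
  case (Suc k)
  \<comment> \<open>\<open>at x\<close> is unrestricted, so the derivative sees \<open>f\<close> on
    a full neighbourhood of \<open>x\<close>; openness of \<open>S\<close> provides one on which
    \<open>f\<close> and \<open>g\<close> agree.\<close>
  have der: "(g has_derivative frechet_derivative f (at x)) (at x)" if "x \<in> S" for x
  proof (rule has_derivative_transform_within_open[OF _ assms(1) that])
    show "(f has_derivative frechet_derivative f (at x)) (at x)"
      using Suc.prems(2) that by (simp add: frechet_derivative_works)
    show "\<And>y. y \<in> S \<Longrightarrow> f y = g y"
      using Suc.prems(1) .
  qed
  have "Ck_on k S (\<lambda>x. frechet_derivative g (at x) v)" for v
  proof (rule Suc.IH)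
    show "Ck_on k S (\<lambda>x. frechet_derivative f (at x) v)"
      using Suc.prems(2) by simp
    show "frechet_derivative f (at x) v = frechet_derivative g (at x) v" if "x \<in> S" for x
      using frechet_derivative_at[OF der[OF that]] by simp
  qed
  then show ?case
    using der by (auto simp: differentiable_def)
qed

lemma Ck_on_subset: "Ck_on k S f \<Longrightarrow> S' \<subseteq> S \<Longrightarrow> Ck_on k S' f"
  by (induction k arbitrary: f) (auto intro: continuous_on_subset)

lemma Ck_on_Suc_imp: "Ck_on (Suc k) S f \<Longrightarrow> Ck_on k S f"
proof (induction k arbitrary: f)
  case 0
  then show ?case
    by (auto intro!: continuous_at_imp_continuous_on differentiable_imp_continuous_within)
next
  case (Suc k)
  then show ?case by (metis Ck_on.simps(2))
qed

lemma Ck_on_const: "Ck_on k S (\<lambda>x. c)"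
  by (induction k arbitrary: c) auto

lemma Ck_on_add:
  assumes "open S" "Ck_on k S f" "Ck_on k S g"
  shows "Ck_on k S (\<lambda>x. f x + g x)"
  using assms(2,3)
proof (induction k arbitrary: f g)
  case 0
  then show ?case by (auto intro: continuous_intros)
next
  case (Suc k)
  have "Ck_on k S (\<lambda>x. frechet_derivative (\<lambda>x. f x + g x) (at x) v)" for v
  proof (rule Ck_on_cong[OF assms(1)])
    show "Ck_on k S (\<lambda>x. frechet_derivative f (at x) v + frechet_derivative g (at x) v)"
      using Suc by simp
    show "frechet_derivative f (at x) v + frechet_derivative g (at x) v =
        frechet_derivative (\<lambda>x. f x + g x) (at x) v" if "x \<in> S" for x
    proof -
      have "((\<lambda>x. f x + g x) has_derivative
          (\<lambda>h. frechet_derivative f (at x) h + frechet_derivative g (at x) h)) (at x)"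
        using Suc.prems that by (intro has_derivative_add) (auto simp: frechet_derivative_works)
      from frechet_derivative_at[OF this] show ?thesis by metis
    qed
  qed
  then show ?case using Suc.prems by simp
qed

lemma Ck_on_mult:
  fixes f g :: "'v::real_normed_vector \<Rightarrow> real"
  assumes "open S" "Ck_on k S f" "Ck_on k S g"
  shows "Ck_on k S (\<lambda>x. f x * g x)"
  using assms(2,3)
proof (induction k arbitrary: f g)
  case 0
  then show ?case by (auto intro: continuous_intros)
next
  case (Suc k)
  have "Ck_on k S (\<lambda>x. frechet_derivative (\<lambda>x. f x * g x) (at x) v)" for v
  proof (rule Ck_on_cong[OF assms(1)])
    \<comment> \<open>Each summand has one undifferentiated factor, whose order is lowered by
      \<open>Ck_on_Suc_imp\<close> so that the induction hypothesis applies.\<close>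
    show "Ck_on k S (\<lambda>x. f x * frechet_derivative g (at x) v + frechet_derivative f (at x) v * g x)"
      using Suc.prems Ck_on_Suc_imp[OF Suc.prems(1)] Ck_on_Suc_imp[OF Suc.prems(2)]
      by (intro Ck_on_add[OF assms(1)] Suc.IH) auto
    show "f x * frechet_derivative g (at x) v + frechet_derivative f (at x) v * g x =
        frechet_derivative (\<lambda>x. f x * g x) (at x) v" if "x \<in> S" for x
    proof -
      have "((\<lambda>x. f x * g x) has_derivative
          (\<lambda>h. f x * frechet_derivative g (at x) h + frechet_derivative f (at x) h * g x)) (at x)"
        using Suc.prems that by (intro has_derivative_mult) (auto simp: frechet_derivative_works)
      from frechet_derivative_at[OF this] show ?thesis by metis
    qed
  qed
  then show ?case using Suc.prems by (simp add: differentiable_mult)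
qed

section \<open>Tangent vectors and brackets\<close>

locale manifold =
  fixes T :: "'a topology" and A :: "('a, 'n::finite) chart set"
  assumes smooth_manifold: "smooth_manifold T A"
begin

section \<open>Smooth functions read in charts\<close>

lemma open_chart_image:
  assumes "(D, \<phi>) \<in> A" "openin T V"
  shows "open (\<phi> ` (D \<inter> V))"
proof -
  have c: "openin T D" "open (\<phi> ` D)"
    and h: "homeomorphic_map (subtopology T D) (top_of_set (\<phi> ` D)) \<phi>"
    using smooth_manifold assms(1) by (auto simp: smooth_manifold_def is_chart_def)
  have "openin (subtopology T D) (D \<inter> V)"
    using assms(2) by (metis Int_commute openin_subtopology)
  then have "openin (top_of_set (\<phi> ` D)) (\<phi> ` (D \<inter> V))"
    using homeomorphic_imp_open_map[OF h] by (simp add: open_map_def)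
  then show ?thesis
    using c(2) openin_open_trans by blast
qed

lemma chart_inv:
  assumes "(D, \<phi>) \<in> A" "x \<in> D"
  shows "inv_into D \<phi> (\<phi> x) = x"
proof -
  have "openin T D" and h: "homeomorphic_map (subtopology T D) (top_of_set (\<phi> ` D)) \<phi>"
    using smooth_manifold assms(1) by (auto simp: smooth_manifold_def is_chart_def)
  then have "inj_on \<phi> D"
    using homeomorphic_imp_injective_map[OF h] by (simp add: openin_subset Int_absorb1)
  then show ?thesis
    using assms(2) by (rule inv_into_f_f)
qed

lemma smooth_fun_cong:
  assumes "openin T V" "\<And>q. q \<in> V \<Longrightarrow> f q = h q" "smooth_fun A V f"
  shows "smooth_fun A V h"
  unfolding smooth_fun_def smooth_on_def
proof clarify
  fix D \<phi> k assume c: "(D, \<phi>) \<in> A"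
  show "Ck_on k (\<phi> ` (D \<inter> V)) (h \<circ> inv_into D \<phi>)"
  proof (rule Ck_on_cong[OF open_chart_image[OF c assms(1)]])
    show "Ck_on k (\<phi> ` (D \<inter> V)) (f \<circ> inv_into D \<phi>)"
      using assms(3) c by (auto simp: smooth_fun_def smooth_on_def)
  qed (use assms(2) chart_inv[OF c] in auto)
qed

lemma smooth_fun_subset: "smooth_fun A V f \<Longrightarrow> V' \<subseteq> V \<Longrightarrow> smooth_fun A V' f"
  unfolding smooth_fun_def smooth_on_def
  by (fastforce intro: Ck_on_subset)

lemma smooth_fun_const: "smooth_fun A V (\<lambda>q. c)"
  by (auto simp: smooth_fun_def smooth_on_def comp_def Ck_on_const)

lemma smooth_fun_add:
  assumes "openin T V" "smooth_fun A V f" "smooth_fun A V h"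
  shows "smooth_fun A V (\<lambda>q. f q + h q)"
  using assms(2,3) Ck_on_add[OF open_chart_image[OF _ assms(1)]]
  by (fastforce simp: smooth_fun_def smooth_on_def comp_def)

lemma smooth_fun_mult:
  assumes "openin T V" "smooth_fun A V f" "smooth_fun A V h"
  shows "smooth_fun A V (\<lambda>q. f q * h q)"
  using assms(2,3) Ck_on_mult[OF open_chart_image[OF _ assms(1)]]
  by (fastforce simp: smooth_fun_def smooth_on_def comp_def)

lemma smooth_fun_uminus:
  assumes "openin T V" "smooth_fun A V f"
  shows "smooth_fun A V (\<lambda>q. - f q)"
  using smooth_fun_mult[OF assms(1) smooth_fun_const[of V "-1"] assms(2)] by simp

lemma smooth_fun_diff:
  assumes "openin T V" "smooth_fun A V f" "smooth_fun A V h"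
  shows "smooth_fun A V (\<lambda>q. f q - h q)"
  using smooth_fun_add[OF assms(1,2) smooth_fun_uminus[OF assms(1,3)]] by simp

lemma smooth_fun_sum:
  assumes "openin T V" "\<And>i. i \<in> I \<Longrightarrow> smooth_fun A V (f i)"
  shows "smooth_fun A V (\<lambda>q. \<Sum>i\<in>I. f i q)"
  using assms(2)
  by (induction I rule: infinite_finite_induct) (auto intro: smooth_fun_const smooth_fun_add[OF assms(1)])

section \<open>Germs of smooth functions\<close>

lemma smooth_nearI: "openin T V \<Longrightarrow> p \<in> V \<Longrightarrow> smooth_fun A V f \<Longrightarrow> smooth_near T A p f"
  by (auto simp: smooth_near_def)

lemma smooth_near_commonE:
  assumes "smooth_near T A p f" "smooth_near T A p h"
  obtains V where "openin T V" "p \<in> V" "smooth_fun A V f" "smooth_fun A V h"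
proof -
  obtain V1 V2 where "openin T V1" "p \<in> V1" "smooth_fun A V1 f"
    "openin T V2" "p \<in> V2" "smooth_fun A V2 h"
    using assms by (auto simp: smooth_near_def)
  then show thesis
    by (intro that[of "V1 \<inter> V2"]) (auto intro: smooth_fun_subset)
qed

lemma smooth_near_withinE:
  assumes "smooth_near T A p f" "openin T U" "p \<in> U"
  obtains V where "openin T V" "p \<in> V" "V \<subseteq> U" "smooth_fun A V f"
proof -
  obtain V where "openin T V" "p \<in> V" "smooth_fun A V f"
    using assms(1) by (auto simp: smooth_near_def)
  then show thesis
    using assms(2,3) by (intro that[of "V \<inter> U"]) (auto intro: smooth_fun_subset)
qed

lemma smooth_near_cong:
  assumes "openin T V" "p \<in> V" "\<And>q. q \<in> V \<Longrightarrow> f q = h q"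
  shows "smooth_near T A p f \<longleftrightarrow> smooth_near T A p h"
proof -
  have "smooth_near T A p h" if "smooth_near T A p f" "\<And>q. q \<in> V \<Longrightarrow> f q = h q" for f h
    using that(1) assms(1,2)
  proof (rule smooth_near_withinE)
    fix V' assume "openin T V'" "p \<in> V'" "V' \<subseteq> V" "smooth_fun A V' f"
    then show ?thesis
      using smooth_fun_cong[of V' f h] that(2) by (auto intro: smooth_nearI)
  qed
  then show ?thesis using assms(3) by metis
qed

lemma smooth_near_add:
  "smooth_near T A p f \<Longrightarrow> smooth_near T A p h \<Longrightarrow> smooth_near T A p (\<lambda>q. f q + h q)"
  by (erule (1) smooth_near_commonE) (rule smooth_nearI, assumption+, rule smooth_fun_add)

lemma smooth_near_mult:
  "smooth_near T A p f \<Longrightarrow> smooth_near T A p h \<Longrightarrow> smooth_near T A p (\<lambda>q. f q * h q)"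
  by (erule (1) smooth_near_commonE) (rule smooth_nearI, assumption+, rule smooth_fun_mult)

lemma smooth_near_const: "p \<in> topspace T \<Longrightarrow> smooth_near T A p (\<lambda>q. c)"
  using smooth_fun_const by (auto intro: smooth_nearI[of "topspace T"])

lemma smooth_near_sum:
  assumes "p \<in> topspace T" "\<And>i. i \<in> I \<Longrightarrow> smooth_near T A p (f i)"
  shows "smooth_near T A p (\<lambda>q. \<Sum>i\<in>I. f i q)"
  using assms(2)
  by (induction I rule: infinite_finite_induct) (auto intro: smooth_near_const[OF assms(1)] smooth_near_add)

section \<open>Tangent vectors as derivations\<close>

lemma tangent_nonsmooth: "v \<in> tangent_space T A p \<Longrightarrow> \<not> smooth_near T A p f \<Longrightarrow> v f = 0"
  by (auto simp: tangent_space_def)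

lemma tangent_local:
  assumes "v \<in> tangent_space T A p" "openin T V" "p \<in> V" "\<And>q. q \<in> V \<Longrightarrow> f q = h q"
  shows "v f = v h"
proof -
  have "\<forall>f g V. openin T V \<and> p \<in> V \<and> (\<forall>q\<in>V. f q = g q) \<longrightarrow> v f = v g"
    using assms(1) by (simp add: tangent_space_def)
  then show ?thesis
    using assms(2-4) by blast
qed

lemma tangent_scale:
  "v \<in> tangent_space T A p \<Longrightarrow> smooth_near T A p f \<Longrightarrow> v (\<lambda>q. c * f q) = c * v f"
  by (auto simp: tangent_space_def)

lemma tangent_add:
  "v \<in> tangent_space T A p \<Longrightarrow> smooth_near T A p f \<Longrightarrow> smooth_near T A p h \<Longrightarrow>
    v (\<lambda>q. f q + h q) = v f + v h"
  by (auto simp: tangent_space_def)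

lemma tangent_mult:
  "v \<in> tangent_space T A p \<Longrightarrow> smooth_near T A p f \<Longrightarrow> smooth_near T A p h \<Longrightarrow>
    v (\<lambda>q. f q * h q) = v f * h p + f p * v h"
  by (auto simp: tangent_space_def)

lemma tangent_uminus:
  "v \<in> tangent_space T A p \<Longrightarrow> smooth_near T A p f \<Longrightarrow> v (\<lambda>q. - f q) = - v f"
  using tangent_scale[of v p f "-1"] by simp

lemma tangent_diff:
  assumes "v \<in> tangent_space T A p" "smooth_near T A p f" "smooth_near T A p h"
  shows "v (\<lambda>q. f q - h q) = v f - v h"
proof -
  have "p \<in> topspace T"
    using assms(2) openin_subset by (auto simp: smooth_near_def)
  then have "smooth_near T A p (\<lambda>q. - h q)"
    using smooth_near_mult[OF smooth_near_const[of p "-1"] assms(3)] by simp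
  from tangent_add[OF assms(1,2) this] tangent_uminus[OF assms(1,3)]
  show ?thesis by simp
qed

lemma tangent_const:
  assumes "v \<in> tangent_space T A p" "p \<in> topspace T"
  shows "v (\<lambda>q. c) = 0"
  \<comment> \<open>The product rule for \<open>1 * 1\<close> at \<open>p\<close> gives
    \<open>v 1 = v 1 + v 1\<close>, so \<open>v\<close> kills 1; scaling then covers
    \<open>c\<close>.\<close>
  using tangent_mult[OF assms(1) smooth_near_const[OF assms(2), of 1] smooth_near_const[OF assms(2), of 1]]
    tangent_scale[OF assms(1) smooth_near_const[OF assms(2), of 1], of c] by simp

lemma tangent_sum:
  assumes "v \<in> tangent_space T A p" "p \<in> topspace T" "\<And>i. i \<in> I \<Longrightarrow> smooth_near T A p (f i)"
  shows "v (\<lambda>q. \<Sum>i\<in>I. f i q) = (\<Sum>i\<in>I. v (f i))"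
  using assms(3)
proof (induction I rule: infinite_finite_induct)
  case (insert i I)
  then show ?case
    using tangent_add[OF assms(1), of "f i" "\<lambda>q. \<Sum>i\<in>I. f i q"] smooth_near_sum[OF assms(2), of I f]
    by simp
qed (use tangent_const[OF assms(1,2)] in auto)

lemma tangent_sum_mult:
  assumes "v \<in> tangent_space T A p" "p \<in> topspace T"
    "\<And>i. i \<in> I \<Longrightarrow> smooth_near T A p (f i)" "\<And>i. i \<in> I \<Longrightarrow> smooth_near T A p (h i)"
  shows "v (\<lambda>q. \<Sum>i\<in>I. f i q * h i q) = (\<Sum>i\<in>I. v (f i) * h i p + f i p * v (h i))"
  using assms(3,4)
  by (subst tangent_sum[OF assms(1,2)]) (auto intro: smooth_near_mult simp: tangent_mult[OF assms(1)])

lemma zero_in_tangent_space: "(\<lambda>f. 0) \<in> tangent_space T A p"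
  by (auto simp: tangent_space_def)

lemma tangent_lincomb:
  assumes "u \<in> tangent_space T A p" "v \<in> tangent_space T A p"
  shows "(\<lambda>f. a * u f + b * v f) \<in> tangent_space T A p"
  unfolding tangent_space_def
proof (intro CollectI conjI allI impI)
  show "a * u f + b * v f = 0" if "\<not> smooth_near T A p f" for f
    using assms[THEN tangent_nonsmooth] that by simp
  show "a * u f + b * v f = a * u h + b * v h"
    if "openin T V \<and> p \<in> V \<and> (\<forall>q\<in>V. f q = h q)" for f h V
    using assms[THEN tangent_local, of V f h] that by simp
qed (use assms in \<open>auto simp: tangent_scale tangent_add tangent_mult algebra_simps\<close>)

lemma tangent_sum_vectors:
  assumes "\<And>i. i \<in> I \<Longrightarrow> u i \<in> tangent_space T A p"
  shows "(\<lambda>f. \<Sum>i\<in>I. c i * u i f) \<in> tangent_space T A p"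
  using assms
proof (induction I rule: infinite_finite_induct)
  case (insert i I)
  then show ?case
    using tangent_lincomb[of "u i" p "\<lambda>f. \<Sum>i\<in>I. c i * u i f" "c i" 1] by simp
qed (auto simp: zero_in_tangent_space)

lemma linear_at_sum:
  assumes "linear_at T A p \<alpha>" "\<And>i. i \<in> I \<Longrightarrow> u i \<in> tangent_space T A p"
  shows "\<alpha> (\<lambda>f. \<Sum>i\<in>I. c i * u i f) = (\<Sum>i\<in>I. c i * \<alpha> (u i))"
proof -
  have lin: "\<alpha> (\<lambda>f. a * u f + b * v f) = a * \<alpha> u + b * \<alpha> v"
    if "u \<in> tangent_space T A p" "v \<in> tangent_space T A p" for u v a b
    using assms(1) that by (auto simp: linear_at_def)
  have "\<alpha> (\<lambda>f. 0) = 0"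
    using lin[OF zero_in_tangent_space zero_in_tangent_space, of 0 0] by simp
  then show ?thesis
    using assms(2)
  proof (induction I rule: infinite_finite_induct)
    case (insert i I)
    then show ?case
      using lin[of "u i" "\<lambda>f. \<Sum>i\<in>I. c i * u i f" "c i" 1] tangent_sum_vectors[of I u p c] by simp
  qed auto
qed

section \<open>Vector fields and their brackets\<close>

lemma vector_field_tangent: "vector_field T A V X \<Longrightarrow> p \<in> V \<Longrightarrow> X p \<in> tangent_space T A p"
  by (auto simp: vector_field_def)

lemma vector_field_subset: "vector_field T A V X \<Longrightarrow> V' \<subseteq> V \<Longrightarrow> vector_field T A V' X"
  unfolding vector_field_def by blast

lemma vector_field_smooth:
  "vector_field T A V X \<Longrightarrow> openin T V' \<Longrightarrow> V' \<subseteq> V \<Longrightarrow> smooth_fun A V' f \<Longrightarrow>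
    smooth_fun A V' (\<lambda>p. X p f)"
  by (auto simp: vector_field_def)

lemma vector_field_smooth_near:
  assumes "vector_field T A V X" "openin T V" "p \<in> V" "smooth_near T A p f"
  shows "smooth_near T A p (\<lambda>q. X q f)"
  using assms(4,2,3)
  by (rule smooth_near_withinE) (metis assms(1) smooth_nearI vector_field_smooth)

text \<open>The rules for \<open>Z q\<close> are available only where the functions are smooth, so
  rewriting an inner derivative gives equality near \<open>p\<close> only. Locality of
  \<open>v\<close> still carries that equality through the outer derivative.\<close>

lemma vector_field_eventually:
  assumes "vector_field T A V X" "openin T V" "p \<in> V" "v \<in> tangent_space T A p"
    "smooth_near T A p f" "smooth_near T A p h"
    "\<And>q. q \<in> V \<Longrightarrow> smooth_near T A q f \<Longrightarrow> smooth_near T A q h \<Longrightarrow> F q = G q"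
  shows "v F = v G"
proof -
  obtain V' where V': "openin T V'" "p \<in> V'" "smooth_fun A V' f" "smooth_fun A V' h"
    using assms(5,6) by (rule smooth_near_commonE)
  show ?thesis
  proof (rule tangent_local[OF assms(4)])
    show "openin T (V \<inter> V')" "p \<in> V \<inter> V'"
      using V' assms(2,3) by auto
    show "F q = G q" if "q \<in> V \<inter> V'" for q
      using that V' by (intro assms(7)) (auto intro: smooth_nearI)
  qed
qed

lemma bracket_smooth:
  "smooth_near T A p f \<Longrightarrow> bracket T A X Y p f = X p (\<lambda>q. Y q f) - Y p (\<lambda>q. X q f)"
  by (simp add: bracket_def)

text \<open>A composite of two derivations violates the product rule by mixed first-order terms;
  these are symmetric in the two fields and cancel in the commutator.\<close>

lemma bracket_tangent:
  assumes X: "vector_field T A V X" and Y: "vector_field T A V Y" and V: "openin T V" "p \<in> V"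
  shows "bracket T A X Y p \<in> tangent_space T A p"
proof -
  note Xp = vector_field_tangent[OF X] and Yp = vector_field_tangent[OF Y]
  have p: "p \<in> topspace T" using V openin_subset by auto
  note [intro] = smooth_near_mult smooth_near_add smooth_near_const[OF p]
  have scale: "v (\<lambda>q. Z q (\<lambda>q. c * f q)) = c * v (\<lambda>q. Z q f)"
    and add: "v (\<lambda>q. Z q (\<lambda>q. f q + h q)) = v (\<lambda>q. Z q f) + v (\<lambda>q. Z q h)"
    and mult: "v (\<lambda>q. Z q (\<lambda>q. f q * h q)) =
      v (\<lambda>q. Z q f) * h p + Z p f * v h + v f * Z p h + f p * v (\<lambda>q. Z q h)"
    if f: "smooth_near T A p f" and h: "smooth_near T A p h"
      and Z: "vector_field T A V Z" and v: "v \<in> tangent_space T A p"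
    for f h Z c v
  proof -
    note Zp = vector_field_tangent[OF Z]
    note ev = vector_field_eventually[OF Z V v f h]
    note Zs = vector_field_smooth_near[OF Z V f] vector_field_smooth_near[OF Z V h]
    have "v (\<lambda>q. Z q (\<lambda>q. c * f q)) = v (\<lambda>q. c * Z q f)"
      by (rule ev) (simp add: tangent_scale[OF Zp])
    then show "v (\<lambda>q. Z q (\<lambda>q. c * f q)) = c * v (\<lambda>q. Z q f)"
      using Zs by (simp add: tangent_scale[OF v])
    have "v (\<lambda>q. Z q (\<lambda>q. f q + h q)) = v (\<lambda>q. Z q f + Z q h)"
      by (rule ev) (simp add: tangent_add[OF Zp])
    then show "v (\<lambda>q. Z q (\<lambda>q. f q + h q)) = v (\<lambda>q. Z q f) + v (\<lambda>q. Z q h)"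
      using Zs by (simp add: tangent_add[OF v])
    have "v (\<lambda>q. Z q (\<lambda>q. f q * h q)) = v (\<lambda>q. Z q f * h q + f q * Z q h)"
      by (rule ev) (simp add: tangent_mult[OF Zp])
    also have "\<dots> = v (\<lambda>q. Z q f) * h p + Z p f * v h + v f * Z p h + f p * v (\<lambda>q. Z q h)"
      using Zs f h by (simp add: tangent_mult[OF v] tangent_add[OF v] smooth_near_mult)
    finally show "v (\<lambda>q. Z q (\<lambda>q. f q * h q)) =
      v (\<lambda>q. Z q f) * h p + Z p f * v h + v f * Z p h + f p * v (\<lambda>q. Z q h)" .
  qed
  show ?thesis
    unfolding tangent_space_def
  proof (intro CollectI conjI allI impI)
    show "bracket T A X Y p f = 0" if "\<not> smooth_near T A p f" for f
      using that by (simp add: bracket_def)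
  next
    \<comment> \<open>\<open>f\<close> and \<open>h\<close> may be non-smooth here: their agreement
      passes through the inner vector at every nearby point, then through the outer one, and
      \<open>smooth_near_cong\<close> selects the same branch of \<open>bracket\<close>.\<close>
    fix f h :: "'a \<Rightarrow> real" and V' assume *: "openin T V' \<and> p \<in> V' \<and> (\<forall>q\<in>V'. f q = h q)"
    have "v (\<lambda>q. Z q f) = v (\<lambda>q. Z q h)"
      if "vector_field T A V Z" "v \<in> tangent_space T A p" for v and Z :: "'a vfield"
    proof (rule tangent_local[OF that(2)])
      show "openin T (V \<inter> V')" "p \<in> V \<inter> V'" using * V by auto
      show "Z q f = Z q h" if "q \<in> V \<inter> V'" for q
        using that * vector_field_tangent[OF \<open>vector_field T A V Z\<close>, of q]
        by (intro tangent_local[of "Z q" q V']) auto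
    qed
    from this[OF X Yp[OF V(2)]] this[OF Y Xp[OF V(2)]]
    show "bracket T A X Y p f = bracket T A X Y p h"
      using smooth_near_cong[of V' p f h] * by (simp add: bracket_def)
  next
    fix f h c assume *: "smooth_near T A p f \<and> smooth_near T A p h"
    show "bracket T A X Y p (\<lambda>q. c * f q) = c * bracket T A X Y p f"
      using * scale[OF _ _ X Yp[OF V(2)]] scale[OF _ _ Y Xp[OF V(2)]]
      by (subst (1 2) bracket_smooth) (auto simp: algebra_simps)
    show "bracket T A X Y p (\<lambda>q. f q + h q) = bracket T A X Y p f + bracket T A X Y p h"
      using * add[OF _ _ X Yp[OF V(2)]] add[OF _ _ Y Xp[OF V(2)]]
      by (subst (1 2 3) bracket_smooth) auto
    show "bracket T A X Y p (\<lambda>q. f q * h q) = bracket T A X Y p f * h p + f p * bracket T A X Y p h"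
      using * mult[OF _ _ X Yp[OF V(2)]] mult[OF _ _ Y Xp[OF V(2)]]
      by (subst (1 2 3) bracket_smooth) (auto simp: algebra_simps)
  qed
qed

end
section \<open>Orthonormal frames\<close>

text \<open>Moves factors and inner sums into the conditional, so that sums against Kronecker deltas
  collapse by simplification.\<close>

lemma if_zero_mult:
  fixes x y :: real
  shows "(if P then x else 0) * y = (if P then x * y else 0)"
    and "y * (if P then x else 0) = (if P then y * x else 0)"
    and "(\<Sum>i\<in>S. if P then f i else (0::real)) = (if P then (\<Sum>i\<in>S. f i) else 0)"
  by auto

locale framed_manifold = manifold T A
  for T :: "'a topology" and A :: "('a, 'n::finite) chart set" +
  fixes g :: "'a \<Rightarrow> 'a functional \<Rightarrow> 'a functional \<Rightarrow> real"
    and U :: "'a set"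
    and e :: "'n \<Rightarrow> 'a vfield"
    and \<omega> :: "'n \<Rightarrow> 'a form1"
    and W :: "'n \<Rightarrow> 'n \<Rightarrow> 'a form1"
    and R :: "'n \<Rightarrow> 'n \<Rightarrow> 'n \<Rightarrow> 'n \<Rightarrow> 'a \<Rightarrow> real"
  assumes metric: "riemannian_metric T A g"
    and open_U: "openin T U"
    and frame: "orthonormal_frame T A g U e"
    and coframe: "dual_coframe T A U e \<omega>"
    and connection: "connection_curvature T A U \<omega> W R"
begin

section \<open>Frame, coframe and connection at points of the frame domain\<close>

lemma U_topspace: "p \<in> U \<Longrightarrow> p \<in> topspace T"
  using open_U openin_subset by auto

lemma e_field: "V \<subseteq> U \<Longrightarrow> vector_field T A V (e i)"
  using frame vector_field_subset[of U "e i" V] by (auto simp: orthonormal_frame_def)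

lemma e_tangent: "p \<in> U \<Longrightarrow> e i p \<in> tangent_space T A p"
  using vector_field_tangent[OF e_field[of U]] by simp

lemma e_smooth_near: "p \<in> U \<Longrightarrow> smooth_near T A p f \<Longrightarrow> smooth_near T A p (\<lambda>q. e i q f)"
  using vector_field_smooth_near[OF e_field[of U] open_U] by simp

lemma \<omega>_e: "p \<in> U \<Longrightarrow> \<omega> i p (e j p) = (if i = j then 1 else 0)"
  using coframe by (auto simp: dual_coframe_def)

lemma \<omega>_linear: "p \<in> U \<Longrightarrow> linear_at T A p (\<omega> i p)"
  using coframe by (auto simp: dual_coframe_def one_form_def)

lemma W_linear: "p \<in> U \<Longrightarrow> linear_at T A p (W i j p)"
  using connection by (auto simp: connection_curvature_def one_form_def)

lemma \<omega>_smooth: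
  "openin T V \<Longrightarrow> V \<subseteq> U \<Longrightarrow> vector_field T A V Y \<Longrightarrow> smooth_fun A V (\<lambda>p. \<omega> i p (Y p))"
  using coframe by (auto simp: dual_coframe_def one_form_def)

lemma W_smooth:
  "openin T V \<Longrightarrow> V \<subseteq> U \<Longrightarrow> vector_field T A V Y \<Longrightarrow> smooth_fun A V (\<lambda>p. W i j p (Y p))"
  using connection by (auto simp: connection_curvature_def one_form_def)

lemma W_skew:
  assumes "p \<in> U" "v \<in> tangent_space T A p"
  shows "W j i p v = - W i j p v"
proof -
  have "\<forall>i j. \<forall>p\<in>U. \<forall>v\<in>tangent_space T A p. W i j p v + W j i p v = 0"
    using connection unfolding connection_curvature_def by (elim conjE)
  then have "W i j p v + W j i p v = 0"
    using assms by blast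
  then show ?thesis by simp
qed

lemma R_smooth: "smooth_fun A U (R i j k l)"
proof -
  have "\<forall>i j k l. smooth_fun A U (R i j k l)"
    using connection unfolding connection_curvature_def by (elim conjE)
  then show ?thesis by blast
qed

lemma R_skew_right:
  assumes "p \<in> U"
  shows "R i j l k p = - R i j k l p"
proof -
  have "\<forall>i j k l. \<forall>p\<in>U. R i j k l p = - R i j l k p"
    using connection unfolding connection_curvature_def by (elim conjE)
  then show ?thesis using assms by blast
qed

lemma structure_equations:
  assumes "openin T V" "V \<subseteq> U" "vector_field T A V Y" "vector_field T A V Z" "p \<in> V"
  shows "ext_d T A (\<omega> i) Y Z p = (\<Sum>k\<in>UNIV. wedge (\<omega> k) (W i k) Y Z p)"
    and "ext_d T A (W i j) Y Z p = (\<Sum>k\<in>UNIV. wedge (W k j) (W i k) Y Z p) +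
      1 / 2 * (\<Sum>k\<in>UNIV. \<Sum>l\<in>UNIV. R i j k l p * wedge (\<omega> k) (\<omega> l) Y Z p)"
proof -
  have "\<forall>V Y Z. openin T V \<and> V \<subseteq> U \<and> vector_field T A V Y \<and> vector_field T A V Z \<longrightarrow>
       (\<forall>p\<in>V.
         (\<forall>i. ext_d T A (\<omega> i) Y Z p = (\<Sum>k\<in>UNIV. wedge (\<omega> k) (W i k) Y Z p)) \<and>
         (\<forall>i j. ext_d T A (W i j) Y Z p = (\<Sum>k\<in>UNIV. wedge (W k j) (W i k) Y Z p) +
            1 / 2 * (\<Sum>k\<in>UNIV. \<Sum>l\<in>UNIV. R i j k l p * wedge (\<omega> k) (\<omega> l) Y Z p)))"
    using connection unfolding connection_curvature_def by (elim conjE)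
  from this[rule_format, of V Y Z p] assms
  show "ext_d T A (\<omega> i) Y Z p = (\<Sum>k\<in>UNIV. wedge (\<omega> k) (W i k) Y Z p)"
    and "ext_d T A (W i j) Y Z p = (\<Sum>k\<in>UNIV. wedge (W k j) (W i k) Y Z p) +
      1 / 2 * (\<Sum>k\<in>UNIV. \<Sum>l\<in>UNIV. R i j k l p * wedge (\<omega> k) (\<omega> l) Y Z p)"
    by blast+
qed

lemma W_e_smooth_near: "p \<in> U \<Longrightarrow> smooth_near T A p (\<lambda>q. W i j q (e k q))"
  using W_smooth[OF open_U _ e_field] by (auto intro: smooth_nearI[OF open_U])

lemma \<omega>_smooth_near:
  assumes "local_field T A p X" "p \<in> U"
  shows "smooth_near T A p (\<lambda>q. \<omega> i q (X q))"
proof -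
  obtain V where "openin T V" "p \<in> V" "vector_field T A V X"
    using assms(1) by (auto simp: local_field_def)
  then show ?thesis
    using assms(2) open_U \<omega>_smooth[of "V \<inter> U" X i] vector_field_subset[of V X "V \<inter> U"]
    by (auto intro: smooth_nearI[of "V \<inter> U"])
qed

section \<open>Expansion in the frame\<close>

lemma tangent_expand:
  assumes "p \<in> U" "v \<in> tangent_space T A p"
  shows "v = (\<lambda>f. \<Sum>i\<in>UNIV. \<omega> i p v * e i p f)"
proof -
  obtain c where c: "v = (\<lambda>f. \<Sum>i\<in>UNIV. c i * e i p f)"
    using frame assms unfolding orthonormal_frame_def by blast
  have "\<omega> j p v = c j" for j
    unfolding c using assms(1)
    by (subst linear_at_sum[OF \<omega>_linear]) (auto simp: e_tangent \<omega>_e if_zero_mult)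
  then show ?thesis using c by simp
qed

lemma tangent_apply:
  "p \<in> U \<Longrightarrow> v \<in> tangent_space T A p \<Longrightarrow> v f = (\<Sum>i\<in>UNIV. \<omega> i p v * e i p f)"
  by (drule (1) tangent_expand) meson

lemma linear_expand:
  assumes "p \<in> U" "v \<in> tangent_space T A p" "linear_at T A p \<alpha>"
  shows "\<alpha> v = (\<Sum>i\<in>UNIV. \<omega> i p v * \<alpha> (e i p))"
  using linear_at_sum[OF assms(3), of UNIV "\<lambda>i. e i p" "\<lambda>i. \<omega> i p v"] e_tangent[OF assms(1)]
    tangent_expand[OF assms(1,2)] by metis

lemma \<omega>_sum_e:
  assumes "p \<in> U"
  shows "\<omega> i p (\<lambda>f. \<Sum>j\<in>UNIV. c j * e j p f) = c i"
  using assms by (subst linear_at_sum[OF \<omega>_linear]) (auto simp: e_tangent \<omega>_e if_zero_mult)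

text \<open>Tangent vectors vanish on non-smooth functions, so testing on smooth germs already
  yields the zero functional, and the coframe reads off the coefficients. This separates components
  in the Jacobi identity and in the comparison of jets.\<close>

lemma frame_independent:
  assumes "p \<in> U" "\<And>f. smooth_near T A p f \<Longrightarrow> (\<Sum>i\<in>UNIV. c i * e i p f) = 0"
  shows "c i = 0"
proof -
  have "(\<lambda>f. \<Sum>i\<in>UNIV. c i * e i p f) = (\<lambda>f. \<Sum>i\<in>UNIV. 0 * e i p f)"
    using assms tangent_nonsmooth[OF e_tangent] by (fastforce intro!: ext)
  then show ?thesis
    using \<omega>_sum_e[OF assms(1), of i c] \<omega>_sum_e[OF assms(1), of i "\<lambda>_. 0"] by metis
qed

lemma metric_expand:
  assumes "p \<in> U" "u \<in> tangent_space T A p" "v \<in> tangent_space T A p"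
  shows "g p u v = (\<Sum>i\<in>UNIV. \<omega> i p u * \<omega> i p v)"
proof -
  have lin: "linear_at T A p (g p w)" and sym: "g p w w' = g p w' w"
    if "w \<in> tangent_space T A p" "w' \<in> tangent_space T A p" for w w'
    using metric U_topspace[OF assms(1)] that by (auto simp: riemannian_metric_def)
  have "g p (e j p) (e i p) = (if j = i then 1 else 0)" for i j
    using frame assms(1) by (auto simp: orthonormal_frame_def)
  \<comment> \<open>The metric is given as linear in its second argument; symmetry moves
    \<open>u\<close> there.\<close>
  then have "g p u (e j p) = \<omega> j p u" for j
    using linear_expand[OF assms(1,2) lin[OF e_tangent[OF assms(1)] assms(2)], of j]
      sym[OF assms(2) e_tangent[OF assms(1)]] by (simp add: if_zero_mult)
  then show ?thesis
    using linear_expand[OF assms(1,3) lin[OF assms(2,3)]] by (simp add: mult.commute)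
qed

section \<open>Covariant derivative and the Killing equation\<close>

text \<open>\<open>cov X i k\<close> is the coefficient \<open>\<xi>\<^sup>i\<^sub>k\<close> of the covariant differential \<open>d\<xi>\<^sup>i + \<xi>\<^sup>m \<omega>\<^sup>i\<^sub>m = \<xi>\<^sup>i\<^sub>k \<omega>\<^sup>k\<close>.\<close>

definition cov :: "'a vfield \<Rightarrow> 'n \<Rightarrow> 'n \<Rightarrow> 'a \<Rightarrow> real" where
  "cov X i k p = e k p (\<lambda>q. \<omega> i q (X q)) + (\<Sum>m\<in>UNIV. \<omega> m p (X p) * W i m p (e k p))"

text \<open>Both sides of the relation defining \<open>cov\<close> are linear in \<open>v\<close>,
  so it extends from the frame vectors to every tangent vector.\<close>

lemma cov_apply:
  assumes "p \<in> U" "v \<in> tangent_space T A p"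
  shows "v (\<lambda>q. \<omega> i q (X q)) =
    (\<Sum>k\<in>UNIV. \<omega> k p v * cov X i k p) - (\<Sum>m\<in>UNIV. \<omega> m p (X p) * W i m p v)"
proof -
  have "(\<Sum>m\<in>UNIV. \<omega> m p (X p) * W i m p v) =
      (\<Sum>m\<in>UNIV. \<Sum>k\<in>UNIV. \<omega> k p v * (\<omega> m p (X p) * W i m p (e k p)))"
    by (subst linear_expand[OF assms W_linear[OF assms(1)]]) (simp add: sum_distrib_left mult_ac)
  also have "\<dots> = (\<Sum>k\<in>UNIV. \<omega> k p v * (\<Sum>m\<in>UNIV. \<omega> m p (X p) * W i m p (e k p)))"
    by (subst sum.swap) (simp add: sum_distrib_left)
  finally show ?thesis
    unfolding cov_def tangent_apply[OF assms, of "\<lambda>q. \<omega> i q (X q)"]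
    by (simp add: sum.distrib distrib_left)
qed

lemma cov_smooth:
  assumes "openin T V" "V \<subseteq> U" "vector_field T A V X"
  shows "smooth_fun A V (cov X i k)"
  unfolding cov_def
  using vector_field_smooth[OF e_field[OF assms(2)] assms(1)] \<omega>_smooth[OF assms]
    W_smooth[OF assms(1,2) e_field[OF assms(2)]]
  by (intro smooth_fun_add smooth_fun_sum smooth_fun_mult assms) auto

text \<open>This is the first structure equation, i.e. absence of torsion, solved for the bracket
  term inside \<open>ext_d\<close>.\<close>

lemma bracket_coord:
  assumes "openin T V" "V \<subseteq> U" "vector_field T A V X" "vector_field T A V Y" "p \<in> V"
  shows "\<omega> i p (bracket T A X Y p) = X p (\<lambda>q. \<omega> i q (Y q)) - Y p (\<lambda>q. \<omega> i q (X q))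
    - (\<Sum>k\<in>UNIV. \<omega> k p (X p) * W i k p (Y p) - \<omega> k p (Y p) * W i k p (X p))"
  using structure_equations(1)[OF assms, of i] by (simp add: ext_d_def wedge_def)

text \<open>The derivatives of the components of \<open>Y\<close> and \<open>Z\<close> along
  \<open>X\<close> cancel against the Leibniz expansion of the metric term, and the terms with
  \<open>W\<close> evaluated on \<open>X\<close> cancel because \<open>W\<close> is skew. Only the
  covariant derivatives of \<open>X\<close> remain.\<close>

lemma lie_derivative_metric_coord:
  assumes V: "openin T V" "V \<subseteq> U" "p \<in> V"
    and X: "vector_field T A V X" and Y: "vector_field T A V Y" and Z: "vector_field T A V Z"
  shows "lie_derivative_metric T A X g Y Z p =
    (\<Sum>i\<in>UNIV. \<Sum>k\<in>UNIV. (cov X i k p + cov X k i p) * \<omega> k p (Y p) * \<omega> i p (Z p))"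
proof -
  have p: "p \<in> U" using V by auto
  have tan: "X p \<in> tangent_space T A p" "Y p \<in> tangent_space T A p" "Z p \<in> tangent_space T A p"
    using X Y Z V(3) vector_field_tangent by auto
  \<comment> \<open>Expressing the derivative of the components of \<open>X\<close> by
    \<open>cov_apply\<close> removes the terms in which \<open>W\<close> is evaluated on
    \<open>B\<close>.\<close>
  have br: "\<omega> i p (bracket T A X B p) = X p (\<lambda>q. \<omega> i q (B q)) -
      (\<Sum>k\<in>UNIV. \<omega> k p (B p) * cov X i k p) + (\<Sum>k\<in>UNIV. \<omega> k p (B p) * W i k p (X p))"
    if B: "vector_field T A V B" for i B
    using cov_apply[OF p vector_field_tangent[OF B V(3)], of i X]
    by (simp add: bracket_coord[OF V(1,2) X B V(3)] sum_subtractf)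
  have "X p (\<lambda>q. g q (Y q) (Z q)) = X p (\<lambda>q. \<Sum>i\<in>UNIV. \<omega> i q (Y q) * \<omega> i q (Z q))"
    using V Y Z vector_field_tangent by (intro tangent_local[OF tan(1) V(1,3)] metric_expand) auto
  also have "\<dots> = (\<Sum>i\<in>UNIV. X p (\<lambda>q. \<omega> i q (Y q)) * \<omega> i p (Z p) + \<omega> i p (Y p) * X p (\<lambda>q. \<omega> i q (Z q)))"
    using V \<omega>_smooth[OF V(1,2) Y] \<omega>_smooth[OF V(1,2) Z]
    by (intro tangent_sum_mult[OF tan(1) U_topspace[OF p]]) (auto intro: smooth_nearI)
  finally have main: "X p (\<lambda>q. g q (Y q) (Z q)) = \<dots>" .
  have gY: "g p (bracket T A X Y p) (Z p) = (\<Sum>i\<in>UNIV. \<omega> i p (bracket T A X Y p) * \<omega> i p (Z p))"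
    and gZ: "g p (Y p) (bracket T A X Z p) = (\<Sum>i\<in>UNIV. \<omega> i p (Y p) * \<omega> i p (bracket T A X Z p))"
    using tan bracket_tangent[OF X Y V(1,3)] bracket_tangent[OF X Z V(1,3)]
    by (auto intro!: metric_expand[OF p])
  have skew: "(\<Sum>i\<in>UNIV. \<Sum>k\<in>UNIV. \<omega> i p (Y p) * (\<omega> k p (Z p) * W i k p (X p))) =
      - (\<Sum>i\<in>UNIV. \<Sum>k\<in>UNIV. \<omega> k p (Y p) * (\<omega> i p (Z p) * W i k p (X p)))"
    by (subst sum.swap, subst W_skew[OF p tan(1)]) (simp add: sum_negf)
  have swap: "(\<Sum>i\<in>UNIV. \<Sum>k\<in>UNIV. \<omega> i p (Y p) * (\<omega> k p (Z p) * cov X i k p)) =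
      (\<Sum>i\<in>UNIV. \<Sum>k\<in>UNIV. \<omega> k p (Y p) * (\<omega> i p (Z p) * cov X k i p))"
    by (subst sum.swap) simp
  show ?thesis
    unfolding lie_derivative_metric_def main gY gZ br[OF Y] br[OF Z]
    using skew swap
    by (simp add: algebra_simps sum.distrib sum_subtractf sum_distrib_left sum_distrib_right)
qed

text \<open>Frame fields are admissible test fields, and on them the bilinear expression returns its
  individual coefficients.\<close>

lemma killing_field_iff_skew:
  assumes V: "openin T V" "V \<subseteq> U" and X: "vector_field T A V X"
  shows "killing_field T A g V X \<longleftrightarrow> (\<forall>p\<in>V. \<forall>i k. cov X i k p + cov X k i p = 0)"
proof
  assume K: "killing_field T A g V X"
  show "\<forall>p\<in>V. \<forall>i k. cov X i k p + cov X k i p = 0"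
  proof (intro ballI allI)
    fix p i k assume p: "p \<in> V"
    have "0 = lie_derivative_metric T A X g (e k) (e i) p"
      using K V p e_field[OF V(2)] unfolding killing_field_def by (metis order_refl)
    also have "\<dots> = cov X i k p + cov X k i p"
      using p V by (subst lie_derivative_metric_coord[OF V p X e_field[OF V(2)] e_field[OF V(2)]])
        (auto simp: \<omega>_e subset_iff if_zero_mult)
    finally show "cov X i k p + cov X k i p = 0" by simp
  qed
next
  assume skew: "\<forall>p\<in>V. \<forall>i k. cov X i k p + cov X k i p = 0"
  show "killing_field T A g V X"
    unfolding killing_field_def
  proof (intro conjI X allI impI ballI)
    fix V' Y Z p
    assume *: "openin T V' \<and> V' \<subseteq> V \<and> vector_field T A V' Y \<and> vector_field T A V' Z" and p: "p \<in> V'"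
    then have "V' \<subseteq> U" "vector_field T A V' X"
      using V vector_field_subset[OF X] by auto
    then show "lie_derivative_metric T A X g Y Z p = 0"
      using * p skew by (subst lie_derivative_metric_coord[of V']) (auto simp: subset_iff)
  qed
qed

section \<open>Structure equations in the frame\<close>

text \<open>\<open>str k a b\<close> is the structure function \<open>c\<^sup>k\<^sub>a\<^sub>b\<close> in \<open>[e\<^sub>a, e\<^sub>b] = c\<^sup>k\<^sub>a\<^sub>b e\<^sub>k\<close>.\<close>

definition str :: "'n \<Rightarrow> 'n \<Rightarrow> 'n \<Rightarrow> 'a \<Rightarrow> real" where
  "str k a b p = W k b p (e a p) - W k a p (e b p)"

text \<open>The components of frame fields are constant, so only the connection terms of
  \<open>bracket_coord\<close> survive.\<close>

lemma \<omega>_bracket_frame: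
  assumes p: "p \<in> U"
  shows "\<omega> k p (bracket T A (e a) (e b) p) = str k a b p"
proof -
  have "v (\<lambda>q. \<omega> k q (e b q)) = 0" if "v \<in> tangent_space T A p" for v b
    using tangent_local[OF that open_U p, of "\<lambda>q. \<omega> k q (e b q)" "\<lambda>q. if k = b then 1 else 0"]
      tangent_const[OF that U_topspace[OF p]] \<omega>_e by simp
  then have "e a p (\<lambda>q. \<omega> k q (e b q)) = 0" "e b p (\<lambda>q. \<omega> k q (e a q)) = 0"
    using e_tangent[OF p] by auto
  then show ?thesis
    using p e_field[of U]
    by (subst bracket_coord[OF open_U])
      (auto simp: str_def \<omega>_e sum_subtractf if_zero_mult)
qed

lemma frame_commutator:
  assumes p: "p \<in> U" and f: "smooth_near T A p f"
  shows "e a p (\<lambda>q. e b q f) - e b p (\<lambda>q. e a q f) = (\<Sum>k\<in>UNIV. str k a b p * e k p f)"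
  using tangent_apply[OF p bracket_tangent[OF e_field e_field open_U p], of a b f]
    \<omega>_bracket_frame[OF p] bracket_smooth[OF f] by simp

lemma curvature_frame:
  assumes p: "p \<in> U"
  shows "e a p (\<lambda>q. W i j q (e b q)) - e b p (\<lambda>q. W i j q (e a q))
      - (\<Sum>k\<in>UNIV. str k a b p * W i j p (e k p)) =
    (\<Sum>k\<in>UNIV. W k j p (e a p) * W i k p (e b p) - W k j p (e b p) * W i k p (e a p)) + R i j a b p"
proof -
  have "ext_d T A (W i j) (e a) (e b) p = (\<Sum>k\<in>UNIV. wedge (W k j) (W i k) (e a) (e b) p) +
      1 / 2 * (\<Sum>k\<in>UNIV. \<Sum>l\<in>UNIV. R i j k l p * wedge (\<omega> k) (\<omega> l) (e a) (e b) p)"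
    by (rule structure_equations(2)[OF open_U order_refl e_field e_field p]) auto
  moreover have "W i j p (bracket T A (e a) (e b) p) = (\<Sum>k\<in>UNIV. str k a b p * W i j p (e k p))"
    using linear_expand[OF p bracket_tangent[OF e_field e_field open_U p] W_linear[OF p], of i j a b]
      \<omega>_bracket_frame[OF p] by simp
  \<comment> \<open>The double sum leaves two terms that coincide up to sign by skewness of
    \<open>R\<close> in its last two indices; this absorbs the factor \<open>1 / 2\<close>.\<close>
  moreover have "(\<Sum>k\<in>UNIV. \<Sum>l\<in>UNIV. R i j k l p * wedge (\<omega> k) (\<omega> l) (e a) (e b) p) =
      R i j a b p - R i j b a p"
    using p by (simp add: wedge_def \<omega>_e right_diff_distrib sum_subtractf if_zero_mult)
  ultimately show ?thesis
    using R_skew_right[OF p, of i j b a] by (simp add: ext_d_def wedge_def)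
qed

text \<open>Inherited from skewness of \<open>W\<close>: exchanging \<open>i\<close> and
  \<open>j\<close> changes the sign of every other term of the second structure equation. In the
  quadratic term, two sign changes and the exchange of the factors combine to one.\<close>

lemma R_skew_left:
  assumes p: "p \<in> U"
  shows "R j i a b p = - R i j a b p"
proof -
  have d_skew: "v (\<lambda>q. W j i q (e b q)) = - v (\<lambda>q. W i j q (e b q))"
    if v: "v \<in> tangent_space T A p" for v b
  proof -
    have "v (\<lambda>q. W j i q (e b q)) = v (\<lambda>q. - W i j q (e b q))"
      using W_skew[OF _ e_tangent, of _ j i] by (intro tangent_local[OF v open_U p]) simp
    then show ?thesis using tangent_uminus[OF v W_e_smooth_near[OF p]] by simp
  qed
  have "e a p (\<lambda>q. W j i q (e b q)) = - e a p (\<lambda>q. W i j q (e b q))"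
    "e b p (\<lambda>q. W j i q (e a q)) = - e b p (\<lambda>q. W i j q (e a q))"
    by (rule d_skew[OF e_tangent[OF p]])+
  moreover have "(\<Sum>k\<in>UNIV. W k i p (e a p) * W j k p (e b p) - W k i p (e b p) * W j k p (e a p)) =
      - (\<Sum>k\<in>UNIV. W k j p (e a p) * W i k p (e b p) - W k j p (e b p) * W i k p (e a p))"
    unfolding sum_negf[symmetric]
    by (intro sum.cong refl)
      (metis (no_types) W_skew[OF p e_tangent[OF p]] minus_mult_minus minus_diff_eq mult.commute)
  moreover have "(\<Sum>k\<in>UNIV. str k a b p * W j i p (e k p)) = - (\<Sum>k\<in>UNIV. str k a b p * W i j p (e k p))"
    by (simp add: W_skew[OF p e_tangent[OF p], of j i] flip: sum_negf)
  ultimately show ?thesis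
    using curvature_frame[OF p, of a i j b] curvature_frame[OF p, of a j i b] by linarith
qed

text \<open>The Jacobi identity of the frame fields, written with structure functions and obtained
  by applying cyclic triple derivatives to a test function.\<close>

lemma jacobi_frame:
  assumes p: "p \<in> U"
  shows "e j p (str m a b) + e a p (str m b j) + e b p (str m j a) + (\<Sum>k\<in>UNIV.
    str k a b p * str m j k p + str k b j p * str m a k p + str k j a p * str m b k p) = 0"
proof (rule frame_independent[OF p, where c = "\<lambda>m. e j p (str m a b) + e a p (str m b j) + e b p (str m j a) +
    (\<Sum>k\<in>UNIV. str k a b p * str m j k p + str k b j p * str m a k p + str k j a p * str m b k p)"])
  fix f assume f: "smooth_near T A p f"
  have str_near: "smooth_near T A p (str k a b)" for k a b
    unfolding str_def using smooth_nearI[OF open_U p] W_smooth[OF open_U _ e_field[of U]]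
    by (simp add: smooth_fun_diff[OF open_U])
  have *: "e j p (\<lambda>q. e a q (\<lambda>r. e b r f)) - e j p (\<lambda>q. e b q (\<lambda>r. e a r f)) =
      (\<Sum>k\<in>UNIV. e j p (str k a b) * e k p f) + e a p (\<lambda>q. e b q (\<lambda>r. e j r f)) -
      e b p (\<lambda>q. e a q (\<lambda>r. e j r f)) + (\<Sum>m\<in>UNIV. (\<Sum>k\<in>UNIV. str k a b p * str m j k p) * e m p f)"
    for j a b
  proof -
    have near: "smooth_near T A p (\<lambda>q. e a q f)" for a
      by (rule e_smooth_near[OF p f])
    have "e j p (\<lambda>q. e a q (\<lambda>r. e b r f)) - e j p (\<lambda>q. e b q (\<lambda>r. e a r f)) =
        e j p (\<lambda>q. e a q (\<lambda>r. e b r f) - e b q (\<lambda>r. e a r f))"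
      by (rule tangent_diff[OF e_tangent[OF p], symmetric]) (intro e_smooth_near[OF p] f)+
    also have "\<dots> = e j p (\<lambda>q. \<Sum>k\<in>UNIV. str k a b q * e k q f)"
      by (rule vector_field_eventually[OF e_field[OF order_refl] open_U p e_tangent[OF p] f f])
        (rule frame_commutator)
    also have "\<dots> = (\<Sum>k\<in>UNIV. e j p (str k a b) * e k p f + str k a b p * e j p (\<lambda>q. e k q f))"
      by (rule tangent_sum_mult[OF e_tangent[OF p] U_topspace[OF p]]) (rule str_near near)+
    also have "\<dots> = (\<Sum>k\<in>UNIV. e j p (str k a b) * e k p f) +
        (\<Sum>k\<in>UNIV. str k a b p * e k p (\<lambda>q. e j q f)) +
        (\<Sum>k\<in>UNIV. str k a b p * (\<Sum>m\<in>UNIV. str m j k p * e m p f))"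
    proof -
      have "e j p (\<lambda>q. e k q f) = e k p (\<lambda>q. e j q f) + (\<Sum>m\<in>UNIV. str m j k p * e m p f)" for k
        using frame_commutator[OF p f, of j k] by simp
      then show ?thesis
        by (simp add: sum.distrib distrib_left)
    qed
    \<comment> \<open>Here the commutator of \<open>e a\<close> and \<open>e b\<close> is read
      backwards, applied to the function \<open>e j f\<close>: the remaining second-order terms
      become third-order ones.\<close>
    also have "(\<Sum>k\<in>UNIV. str k a b p * e k p (\<lambda>q. e j q f)) =
        e a p (\<lambda>q. e b q (\<lambda>r. e j r f)) - e b p (\<lambda>q. e a q (\<lambda>r. e j r f))"
      using frame_commutator[OF p near, of a b j] by simp
    also have "(\<Sum>k\<in>UNIV. str k a b p * (\<Sum>m\<in>UNIV. str m j k p * e m p f)) =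
        (\<Sum>m\<in>UNIV. (\<Sum>k\<in>UNIV. str k a b p * str m j k p) * e m p f)"
      unfolding sum_distrib_left sum_distrib_right by (subst sum.swap) (simp add: mult_ac)
    finally show ?thesis by simp
  qed
  show "(\<Sum>m\<in>UNIV. (e j p (str m a b) + e a p (str m b j) + e b p (str m j a) + (\<Sum>k\<in>UNIV.
      str k a b p * str m j k p + str k b j p * str m a k p + str k j a p * str m b k p)) * e m p f) = 0"
    \<comment> \<open>In the cyclic sum all third-order derivatives cancel.\<close>
    using *[of j a b] *[of a b j] *[of b j a]
    by (simp add: sum.distrib distrib_right)
qed

text \<open>In the cyclic sum of the second structure equations, the derivatives of connection
  coefficients combine to derivatives of \<open>str\<close>. These and the quadratic terms form
  component \<open>i\<close> of the Jacobi identity, so only curvature is left.\<close>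

lemma first_bianchi:
  assumes p: "p \<in> U"
  shows "R i j a b p + R i a b j p + R i b j a p = 0"
proof -
  have d_str: "e j p (str k a b) = e j p (\<lambda>q. W k b q (e a q)) - e j p (\<lambda>q. W k a q (e b q))" for j k a b
    unfolding str_def using W_e_smooth_near[OF p] by (intro tangent_diff[OF e_tangent[OF p]])
  show ?thesis
    using curvature_frame[OF p, of a i j b] curvature_frame[OF p, of b i a j]
      curvature_frame[OF p, of j i b a] jacobi_frame[OF p, of j i a b]
    unfolding d_str unfolding str_def
    by (simp add: algebra_simps sum.distrib sum_subtractf)
qed

section \<open>The second covariant derivative of a Killing field\<close>

text \<open>\<open>cov2 X i j l\<close> is the coefficient of \<open>\<omega>\<^sup>l\<close> in \<open>d\<xi>\<^sup>i\<^sub>j - \<xi>\<^sup>i\<^sub>k \<omega>\<^sup>k\<^sub>j + \<xi>\<^sup>k\<^sub>j \<omega>\<^sup>i\<^sub>k\<close>.\<close>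

definition cov2 :: "'a vfield \<Rightarrow> 'n \<Rightarrow> 'n \<Rightarrow> 'n \<Rightarrow> 'a \<Rightarrow> real" where
  "cov2 X i j l p = e l p (cov X i j) - (\<Sum>k\<in>UNIV. cov X i k p * W k j p (e l p))
    + (\<Sum>k\<in>UNIV. cov X k j p * W i k p (e l p))"

lemma ricci_identity:
  assumes V: "openin T V" "V \<subseteq> U" "p \<in> V" and X: "vector_field T A V X"
  shows "cov2 X i b a p - cov2 X i a b p = (\<Sum>k\<in>UNIV. \<omega> k p (X p) * R i k a b p)"
proof -
  have p: "p \<in> U" using V by auto
  let ?\<xi> = "\<lambda>i q. \<omega> i q (X q)"
  have near: "smooth_near T A p (?\<xi> i)" for i
    using \<omega>_smooth[OF V(1,2) X] smooth_nearI[OF V(1,3)] by auto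
  have e_cov: "e a p (cov X i b) = e a p (\<lambda>q. e b q (?\<xi> i)) +
      (\<Sum>m\<in>UNIV. e a p (?\<xi> m) * W i m p (e b p) + ?\<xi> m p * e a p (\<lambda>q. W i m q (e b q)))" for a b
    unfolding cov_def
    by (subst tangent_add[OF e_tangent[OF p]])
      (auto intro!: smooth_near_sum smooth_near_mult near e_smooth_near p W_e_smooth_near U_topspace
        tangent_sum_mult[OF e_tangent[OF p]])
  have e_\<xi>: "e b p (?\<xi> m) = cov X m b p - (\<Sum>k\<in>UNIV. ?\<xi> k p * W m k p (e b p))" for b m
    by (simp add: cov_def)
  \<comment> \<open>\<open>S\<close> collects structure-function terms and \<open>P\<close> terms
    quadratic in the connection. Each arises both from the curvature equation and from
    differentiating the components of \<open>X\<close>; as atoms they cancel by linear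
    arithmetic.\<close>
  define S where "S = (\<Sum>m\<in>UNIV. \<Sum>k\<in>UNIV. ?\<xi> m p * (str k a b p * W i m p (e k p)))"
  have S_swap: "S = (\<Sum>k\<in>UNIV. \<Sum>m\<in>UNIV. ?\<xi> m p * (str k a b p * W i m p (e k p)))"
    unfolding S_def by (rule sum.swap)
  define P where "P a b = (\<Sum>m\<in>UNIV. \<Sum>k\<in>UNIV. ?\<xi> m p * (W k m p (e a p) * W i k p (e b p)))" for a b
  have "(\<Sum>m\<in>UNIV. ?\<xi> m p * (e a p (\<lambda>q. W i m q (e b q)) - e b p (\<lambda>q. W i m q (e a q))
        - (\<Sum>k\<in>UNIV. str k a b p * W i m p (e k p)))) =
      (\<Sum>m\<in>UNIV. ?\<xi> m p * ((\<Sum>k\<in>UNIV. W k m p (e a p) * W i k p (e b p) - W k m p (e b p) * W i k p (e a p))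
        + R i m a b p))"
    by (simp only: curvature_frame[OF p])
  then have curv: "(\<Sum>m\<in>UNIV. ?\<xi> m p * e a p (\<lambda>q. W i m q (e b q)))
      - (\<Sum>m\<in>UNIV. ?\<xi> m p * e b p (\<lambda>q. W i m q (e a q))) - S =
      P a b - P b a + (\<Sum>m\<in>UNIV. ?\<xi> m p * R i m a b p)"
    by (simp add: S_def P_def right_diff_distrib distrib_left sum_subtractf sum.distrib sum_distrib_left)
  have "e a p (\<lambda>q. e b q (?\<xi> i)) - e b p (\<lambda>q. e a q (?\<xi> i)) =
      (\<Sum>k\<in>UNIV. str k a b p * cov X i k p)
      - (\<Sum>k\<in>UNIV. \<Sum>m\<in>UNIV. ?\<xi> m p * (str k a b p * W i m p (e k p)))"
    unfolding frame_commutator[OF p near] e_\<xi>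
    by (simp add: right_diff_distrib sum_subtractf sum_distrib_left mult_ac)
  then have comm: "e a p (\<lambda>q. e b q (?\<xi> i)) - e b p (\<lambda>q. e a q (?\<xi> i)) =
      (\<Sum>k\<in>UNIV. cov X i k p * W k b p (e a p)) - (\<Sum>k\<in>UNIV. cov X i k p * W k a p (e b p)) - S"
    unfolding S_swap by (simp add: str_def right_diff_distrib sum_subtractf mult.commute[of _ "cov X i _ p"])
  have eW: "(\<Sum>m\<in>UNIV. e a p (?\<xi> m) * W i m p (e b p)) =
      (\<Sum>m\<in>UNIV. cov X m a p * W i m p (e b p)) - P a b" for a b
  proof -
    have "P a b = (\<Sum>m\<in>UNIV. \<Sum>k\<in>UNIV. ?\<xi> k p * (W m k p (e a p) * W i m p (e b p)))"
      unfolding P_def by (rule sum.swap)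
    then show ?thesis
      unfolding e_\<xi> left_diff_distrib sum_subtractf by (simp add: sum_distrib_left mult_ac)
  qed
  show ?thesis
    unfolding cov2_def e_cov sum.distrib using curv comm eW[of a b] eW[of b a] by linarith
qed

lemma killing_second_derivative:
  assumes V: "openin T V" "V \<subseteq> U" "p \<in> V" and X: "vector_field T A V X"
    and skew: "\<And>q i k. q \<in> V \<Longrightarrow> cov X i k q + cov X k i q = 0"
  shows "cov2 X i j l p + (\<Sum>k\<in>UNIV. \<omega> k p (X p) * R i j k l p) = 0"
proof -
  have p: "p \<in> U" using V by auto
  define B where "B i j l = cov2 X i j l p + (\<Sum>k\<in>UNIV. \<omega> k p (X p) * R i j k l p)" for i j l
  have cov_skew: "cov X k i q = - cov X i k q" if "q \<in> V" for i k q
    using skew[OF that, of i k] by simp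
  have B_skew: "B j i l = - B i j l" for i j l
  proof -
    have "e l p (cov X j i) = e l p (\<lambda>q. - cov X i j q)"
      using cov_skew[where k = j and i = i] by (intro tangent_local[OF e_tangent[OF p] V(1,3)]) simp
    also have "\<dots> = - e l p (cov X i j)"
      by (intro tangent_uminus[OF e_tangent[OF p]] smooth_nearI[OF V(1,3)] cov_smooth[OF V(1,2) X])
    finally have "e l p (cov X j i) = - e l p (cov X i j)" .
    \<comment> \<open>Under exchange of \<open>i\<close> and \<open>j\<close> the two connection
      sums of \<open>cov2\<close> trade places, each with its sign in \<open>cov2\<close>
      reversed.\<close>
    moreover have "(\<Sum>k\<in>UNIV. cov X j k p * W k i p (e l p)) = (\<Sum>k\<in>UNIV. cov X k j p * W i k p (e l p))"
      for i j
      by (intro sum.cong refl) (metis cov_skew[OF V(3)] W_skew[OF p e_tangent[OF p]] minus_mult_minus)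
    moreover have "(\<Sum>k\<in>UNIV. \<omega> k p (X p) * R j i k l p) = - (\<Sum>k\<in>UNIV. \<omega> k p (X p) * R i j k l p)"
      by (simp add: R_skew_left[OF p, of j i] sum_negf)
    ultimately show ?thesis
      by (simp add: B_def cov2_def)
  qed
  have B_sym: "B i l j = B i j l" for i j l
  proof -
    \<comment> \<open>The additional term is exactly the one produced by the Ricci identity.\<close>
    have "R i l k j p = R i j k l p + R i k l j p" for k
      using first_bianchi[OF p, of i j k l] R_skew_right[OF p, of i l j k] by simp
    then show ?thesis
      using ricci_identity[OF V X, of i j l] by (simp add: B_def distrib_left sum.distrib)
  qed
  \<comment> \<open>Alternating the two symmetries six times returns to the initial index order
    after three sign changes.\<close>
  have "B i j l = - B j i l" "B j i l = B j l i" "B j l i = - B l j i"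
    "B l j i = B l i j" "B l i j = - B i l j" "B i l j = B i j l"
    by (fact B_skew B_sym)+
  then have "B i j l = - B i j l" by simp
  then show ?thesis
    by (simp add: B_def)
qed
section \<open>Jets of vector fields\<close>

lemma local_fieldI: "openin T V \<Longrightarrow> p \<in> V \<Longrightarrow> vector_field T A V X \<Longrightarrow> local_field T A p X"
  by (auto simp: local_field_def)

text \<open>Leibniz rule for \<open>X\<close> written in the frame: its first-order data at
  \<open>p\<close> enter only through \<open>X p\<close> and the derivatives of its
  components.\<close>

lemma field_derivative:
  assumes X: "local_field T A p X" and p: "p \<in> U" and v: "v \<in> tangent_space T A p"
    and f: "smooth_near T A p f"
  shows "v (\<lambda>q. X q f) =
    (\<Sum>i\<in>UNIV. v (\<lambda>q. \<omega> i q (X q)) * e i p f + \<omega> i p (X p) * v (\<lambda>q. e i q f))"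
proof -
  obtain V where V: "openin T V" "p \<in> V" "vector_field T A V X"
    using X by (auto simp: local_field_def)
  have "v (\<lambda>q. X q f) = v (\<lambda>q. \<Sum>i\<in>UNIV. \<omega> i q (X q) * e i q f)"
  proof (rule tangent_local[OF v, of "V \<inter> U"])
    show "X q f = (\<Sum>i\<in>UNIV. \<omega> i q (X q) * e i q f)" if "q \<in> V \<inter> U" for q
      using that vector_field_tangent[OF V(3)] by (intro tangent_apply) auto
  qed (use V p open_U in auto)
  also have "\<dots> = (\<Sum>i\<in>UNIV. v (\<lambda>q. \<omega> i q (X q)) * e i p f + \<omega> i p (X p) * v (\<lambda>q. e i q f))"
    using \<omega>_smooth_near[OF X p] e_smooth_near[OF p f] by (intro tangent_sum_mult[OF v U_topspace[OF p]])
  finally show ?thesis .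
qed

text \<open>When the values at \<open>p\<close> agree, the two expansions by
  \<open>field_derivative\<close> differ only by a combination of the frame vectors, so arbitrary
  test functions separate its coefficients.\<close>

lemma same_jet1_iff:
  assumes X: "local_field T A p X" and Y: "local_field T A p Y" and p: "p \<in> U"
  shows "same_jet1 T A p X Y \<longleftrightarrow>
    X p = Y p \<and> (\<forall>i. \<forall>v\<in>tangent_space T A p. v (\<lambda>q. \<omega> i q (X q)) = v (\<lambda>q. \<omega> i q (Y q)))"
proof
  assume jet: "same_jet1 T A p X Y"
  have "v (\<lambda>q. \<omega> i q (X q)) - v (\<lambda>q. \<omega> i q (Y q)) = 0" if v: "v \<in> tangent_space T A p" for v i
  proof (rule frame_independent[OF p, where c = "\<lambda>i. v (\<lambda>q. \<omega> i q (X q)) - v (\<lambda>q. \<omega> i q (Y q))"])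
    fix f assume f: "smooth_near T A p f"
    have "v (\<lambda>q. X q f) = v (\<lambda>q. Y q f)" "X p = Y p"
      using jet v f by (auto simp: same_jet1_def)
    then show "(\<Sum>i\<in>UNIV. (v (\<lambda>q. \<omega> i q (X q)) - v (\<lambda>q. \<omega> i q (Y q))) * e i p f) = 0"
      unfolding field_derivative[OF X p v f] field_derivative[OF Y p v f]
      by (simp add: sum.distrib left_diff_distrib sum_subtractf)
  qed
  then show "X p = Y p \<and> (\<forall>i. \<forall>v\<in>tangent_space T A p. v (\<lambda>q. \<omega> i q (X q)) = v (\<lambda>q. \<omega> i q (Y q)))"
    using jet by (simp add: same_jet1_def)
next
  assume *: "X p = Y p \<and> (\<forall>i. \<forall>v\<in>tangent_space T A p. v (\<lambda>q. \<omega> i q (X q)) = v (\<lambda>q. \<omega> i q (Y q)))"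
  have "v (\<lambda>q. X q f) = v (\<lambda>q. Y q f)"
    if v: "v \<in> tangent_space T A p" and f: "smooth_near T A p f" for v f
  proof -
    have "v (\<lambda>q. \<omega> i q (X q)) = v (\<lambda>q. \<omega> i q (Y q))" for i
      using * v by blast
    then show ?thesis
      unfolding field_derivative[OF X p v f] field_derivative[OF Y p v f] using * by simp
  qed
  then show "same_jet1 T A p X Y"
    using * by (simp add: same_jet1_def)
qed

lemma jet1_cong:
  assumes "same_jet1 T A p X Y"
  shows "jet1 T A X p = jet1 T A Y p"
proof -
  \<comment> \<open>\<open>D\<close> hides the abstraction over points, which turns the transitivity
    argument into a first-order one.\<close>
  define D where "D Z v f = v (\<lambda>q. Z q f)" for Z :: "'a vfield" and v :: "'a functional" and f
  have jet: "same_jet1 T A p X Y \<longleftrightarrow> X p = Y p \<and>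
      (\<forall>v\<in>tangent_space T A p. \<forall>f. smooth_near T A p f \<longrightarrow> D X v f = D Y v f)" for X Y
    by (simp add: same_jet1_def D_def)
  have "same_jet1 T A p X Z \<longleftrightarrow> same_jet1 T A p Y Z" for Z
    using assms unfolding jet by metis
  then show ?thesis
    by (simp add: jet1_def)
qed

lemma jet1_representative:
  assumes "local_field T A p X"
  defines "Y \<equiv> SOME Y. Y \<in> snd (jet1 T A X p)"
  shows "local_field T A p Y" "same_jet1 T A p X Y"
proof -
  have "X \<in> snd (jet1 T A X p)"
    using assms(1) by (simp add: jet1_def same_jet1_def)
  then have "Y \<in> snd (jet1 T A X p)"
    unfolding Y_def by (rule someI[of "\<lambda>Y. Y \<in> snd (jet1 T A X p)"])
  then show "local_field T A p Y" "same_jet1 T A p X Y"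
    by (auto simp: jet1_def)
qed

text \<open>The coordinates use a chosen representative, but only its value and the derivatives of
  its components at \<open>p\<close>; \<open>same_jet1_iff\<close> shows that these belong to the
  jet.\<close>

lemma
  assumes X: "local_field T A p X" and p: "p \<in> U"
  shows jet_coord_jet1: "jet_coord \<omega> i (jet1 T A X p) = \<omega> i p (X p)"
    and jet_coord1_jet1: "jet_coord1 e \<omega> W i k (jet1 T A X p) = cov X i k p"
proof -
  note Y = jet1_representative[OF X]
  have fst: "fst (jet1 T A X p) = p" by (simp add: jet1_def)
  show "jet_coord \<omega> i (jet1 T A X p) = \<omega> i p (X p)"
    using Y(2) by (simp add: jet_coord_def Let_def fst same_jet1_def)
  show "jet_coord1 e \<omega> W i k (jet1 T A X p) = cov X i k p"
  proof -
    let ?Y = "SOME Y. Y \<in> snd (jet1 T A X p)"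
    have "X p = ?Y p" "e k p (\<lambda>q. \<omega> i q (X q)) = e k p (\<lambda>q. \<omega> i q (?Y q))"
      using Y(2) e_tangent[OF p] unfolding same_jet1_iff[OF X Y(1) p] by blast+
    then show ?thesis
      by (simp add: jet_coord1_def cov_def Let_def fst)
  qed
qed

section \<open>Pullback of the forms along sections\<close>

lemma push_forward_fst_section:
  assumes "openin T V" "p \<in> V" "v \<in> tangent_space T A p" "\<And>q. q \<in> V \<Longrightarrow> fst (s q) = q"
  shows "push_forward fst (push_forward s v) = v"
  \<comment> \<open>The projection inverts \<open>s\<close> on \<open>V\<close> only, which suffices
    by locality of \<open>v\<close>.\<close>
  unfolding push_forward_def using assms by (intro ext tangent_local[OF assms(3,1,2)]) simp

lemma theta1_section:
  assumes "openin T V" "p \<in> V" "v \<in> tangent_space T A p" "\<And>q. q \<in> V \<Longrightarrow> fst (s q) = q"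
  shows "theta1 e \<omega> W i (s p) (push_forward s v) = v (jet_coord \<omega> i \<circ> s)
    + (\<Sum>k\<in>UNIV. jet_coord \<omega> k (s p) * W i k p v)
    - (\<Sum>k\<in>UNIV. jet_coord1 e \<omega> W i k (s p) * \<omega> k p v)"
proof -
  have "push_forward fst (push_forward s v) = v"
    by (rule push_forward_fst_section[OF assms(1-3)]) (rule assms(4))
  moreover have "push_forward s v (jet_coord \<omega> i) = v (jet_coord \<omega> i \<circ> s)"
    by (simp add: push_forward_def)
  ultimately show ?thesis
    by (simp add: theta1_def Let_def assms(4)[OF assms(2)])
qed

lemma theta2_jet1:
  assumes V: "openin T V" "V \<subseteq> U" "p \<in> V" and X: "vector_field T A V X"
    and v: "v \<in> tangent_space T A p"
  shows "theta2 e \<omega> W R i j (jet1 T A X p) (push_forward (jet1 T A X) v) =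
    v (cov X i j) - (\<Sum>k\<in>UNIV. cov X i k p * W k j p v) + (\<Sum>k\<in>UNIV. cov X k j p * W i k p v)
    + (\<Sum>k\<in>UNIV. \<Sum>l\<in>UNIV. \<omega> k p (X p) * R i j k l p * \<omega> l p v)"
proof -
  have fst: "fst (jet1 T A X q) = q" for q by (simp add: jet1_def)
  have coord: "jet_coord \<omega> i (jet1 T A X q) = \<omega> i q (X q)"
    "jet_coord1 e \<omega> W i k (jet1 T A X q) = cov X i k q" if "q \<in> V" for q i k
    using that V(2) local_fieldI[OF V(1) that X] by (auto simp: jet_coord_jet1 jet_coord1_jet1)
  have "push_forward (jet1 T A X) v (jet_coord1 e \<omega> W i j) = v (cov X i j)"
    unfolding push_forward_def using coord by (intro tangent_local[OF v V(1,3)]) simp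
  then show ?thesis
    unfolding theta2_def Let_def fst push_forward_fst_section[OF V(1,3) v fst] coord[OF V(3)] by simp
qed

text \<open>Every term is linear in \<open>v\<close>, so the pulled-back form is determined by its
  frame coefficients; these are the \<open>B\<close> of
  \<open>killing_second_derivative\<close>.\<close>

lemma theta2_expand:
  assumes p: "p \<in> U" and v: "v \<in> tangent_space T A p"
  shows "v (cov X i j) - (\<Sum>k\<in>UNIV. cov X i k p * W k j p v) + (\<Sum>k\<in>UNIV. cov X k j p * W i k p v)
    + (\<Sum>k\<in>UNIV. \<Sum>l\<in>UNIV. \<omega> k p (X p) * R i j k l p * \<omega> l p v) =
    (\<Sum>l\<in>UNIV. \<omega> l p v * (cov2 X i j l p + (\<Sum>k\<in>UNIV. \<omega> k p (X p) * R i j k l p)))"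
proof -
  have W: "(\<Sum>k\<in>UNIV. c k * W (a k) (b k) p v) =
      (\<Sum>l\<in>UNIV. \<omega> l p v * (\<Sum>k\<in>UNIV. c k * W (a k) (b k) p (e l p)))" for c a b
  proof -
    have "(\<Sum>k\<in>UNIV. c k * W (a k) (b k) p v) =
        (\<Sum>k\<in>UNIV. \<Sum>l\<in>UNIV. \<omega> l p v * (c k * W (a k) (b k) p (e l p)))"
      by (subst linear_expand[OF p v W_linear[OF p]]) (simp add: sum_distrib_left mult_ac)
    also have "\<dots> = (\<Sum>l\<in>UNIV. \<Sum>k\<in>UNIV. \<omega> l p v * (c k * W (a k) (b k) p (e l p)))"
      by (rule sum.swap)
    finally show ?thesis
      by (simp add: sum_distrib_left)
  qed
  have Rsum: "(\<Sum>k\<in>UNIV. \<Sum>l\<in>UNIV. \<omega> k p (X p) * R i j k l p * \<omega> l p v) =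
      (\<Sum>l\<in>UNIV. \<omega> l p v * (\<Sum>k\<in>UNIV. \<omega> k p (X p) * R i j k l p))"
    by (subst sum.swap) (simp add: sum_distrib_left mult_ac)
  show ?thesis
    unfolding W Rsum cov2_def tangent_apply[OF p v, of "cov X i j"]
    by (simp add: distrib_left right_diff_distrib sum.distrib sum_subtractf)
qed

lemma vanishes_theta2_iff:
  assumes V: "openin T V" "V \<subseteq> U" and X: "vector_field T A V X"
  shows "vanishes_along T A V (jet1 T A X) (theta2 e \<omega> W R i j) \<longleftrightarrow>
    (\<forall>p\<in>V. \<forall>l. cov2 X i j l p + (\<Sum>k\<in>UNIV. \<omega> k p (X p) * R i j k l p) = 0)"
proof -
  have *: "theta2 e \<omega> W R i j (jet1 T A X p) (push_forward (jet1 T A X) v) =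
      (\<Sum>l\<in>UNIV. \<omega> l p v * (cov2 X i j l p + (\<Sum>k\<in>UNIV. \<omega> k p (X p) * R i j k l p)))"
    if "p \<in> V" "v \<in> tangent_space T A p" for p v
    using theta2_jet1[OF V that(1) X that(2)] theta2_expand[OF _ that(2)] that(1) V(2) by auto
  have **: "(\<Sum>l\<in>UNIV. \<omega> l p (e m p) * c l) = c m" if "p \<in> V" for p m c
    using that V(2) by (simp add: \<omega>_e subset_iff if_zero_mult)
  show ?thesis
  proof
    assume van: "vanishes_along T A V (jet1 T A X) (theta2 e \<omega> W R i j)"
    show "\<forall>p\<in>V. \<forall>l. cov2 X i j l p + (\<Sum>k\<in>UNIV. \<omega> k p (X p) * R i j k l p) = 0"
    proof (intro ballI allI)
      fix p l assume p: "p \<in> V"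
      then have e: "e l p \<in> tangent_space T A p"
        using e_tangent V(2) by blast
      then have "theta2 e \<omega> W R i j (jet1 T A X p) (push_forward (jet1 T A X) (e l p)) = 0"
        using van p by (simp add: vanishes_along_def)
      then show "cov2 X i j l p + (\<Sum>k\<in>UNIV. \<omega> k p (X p) * R i j k l p) = 0"
        unfolding *[OF p e] **[OF p] .
    qed
  qed (simp add: vanishes_along_def *)
qed

lemma jet1_in_skew_jets_iff:
  assumes V: "openin T V" "V \<subseteq> U" "p \<in> V" and X: "vector_field T A V X"
  shows "jet1 T A X p \<in> skew_jets T A U e \<omega> W \<longleftrightarrow> (\<forall>i k. cov X i k p + cov X k i p = 0)"
proof -
  have "local_field T A p X" "p \<in> U"
    using V local_fieldI[OF V(1,3) X] by auto
  then show ?thesis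
    by (auto simp: skew_jets_def J1_def jet_coord1_jet1)
qed

text \<open>The candidate field takes its components from the zeroth-order coordinates of the
  section. Vanishing of \<open>theta1\<close> then forces its first derivatives to be the ones
  recorded in the section.\<close>

lemma contact_iff_holonomic:
  assumes V: "openin T V" "V \<subseteq> U" and s: "jet_section T A e \<omega> W V s"
  shows "(\<forall>i. vanishes_along T A V s (theta1 e \<omega> W i)) \<longleftrightarrow>
    (\<exists>X. vector_field T A V X \<and> (\<forall>p\<in>V. s p = jet1 T A X p))"
proof -
  have fst: "fst (s q) = q" if "q \<in> V" for q
    using s that by (auto simp: jet_section_def)
  show ?thesis
  proof
    assume "\<forall>i. vanishes_along T A V s (theta1 e \<omega> W i)"
    then have \<theta>: "v (jet_coord \<omega> i \<circ> s) + (\<Sum>k\<in>UNIV. jet_coord \<omega> k (s p) * W i k p v)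
        - (\<Sum>k\<in>UNIV. jet_coord1 e \<omega> W i k (s p) * \<omega> k p v) = 0"
      if "p \<in> V" "v \<in> tangent_space T A p" for p v i
      using that theta1_section[OF V(1) that, of s i] fst by (simp add: vanishes_along_def)
    define X where "X p f = (\<Sum>i\<in>UNIV. jet_coord \<omega> i (s p) * e i p f)" for p f
    have X: "vector_field T A V X"
      unfolding vector_field_def
    proof (intro conjI ballI allI impI)
      show "X p \<in> tangent_space T A p" if "p \<in> V" for p
        unfolding X_def using that V e_tangent by (intro tangent_sum_vectors) auto
    next
      fix V' f assume V': "openin T V' \<and> V' \<subseteq> V \<and> smooth_fun A V' f"
      then have "smooth_fun A V' (\<lambda>p. jet_coord \<omega> i (s p))" for i
        using s by (auto simp: jet_section_def comp_def intro: smooth_fun_subset)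
      moreover have "smooth_fun A V' (\<lambda>p. e i p f)" for i
        using V' V vector_field_smooth[OF e_field[OF V(2)]] by blast
      ultimately show "smooth_fun A V' (\<lambda>p. X p f)"
        unfolding X_def using V' by (intro smooth_fun_sum smooth_fun_mult) auto
    qed
    have "s p = jet1 T A X p" if p: "p \<in> V" for p
    proof -
      have pU: "p \<in> U" using p V by auto
      have lX: "local_field T A p X" by (rule local_fieldI[OF V(1) p X])
      \<comment> \<open>\<open>Y\<close> depends on \<open>p\<close>; only its jet at this point is
        compared with that of \<open>X\<close>.\<close>
      obtain Y where Y: "s p = jet1 T A Y p" "local_field T A p Y"
        using s p by (fastforce simp: jet_section_def J1_def jet1_def)
      have "\<omega> i q (X q) = jet_coord \<omega> i (s q)" if "q \<in> V" for q i
        unfolding X_def using that V by (intro \<omega>_sum_e) auto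
      then have dX: "v (\<lambda>q. \<omega> i q (X q)) = v (jet_coord \<omega> i \<circ> s)" if "v \<in> tangent_space T A p" for v i
        by (intro tangent_local[OF that V(1) p]) simp
      have "Y p \<in> tangent_space T A p"
        using Y(2) vector_field_tangent by (auto simp: local_field_def)
      from tangent_expand[OF pU this] have "X p = Y p"
        unfolding X_def Y(1) jet_coord_jet1[OF Y(2) pU] by (rule sym)
      \<comment> \<open>The contact equation for \<open>X\<close> and \<open>cov_apply\<close> for
        \<open>Y\<close> compute both derivatives from the same fiber coordinates of
        \<open>s p\<close>.\<close>
      moreover have "v (\<lambda>q. \<omega> i q (X q)) = v (\<lambda>q. \<omega> i q (Y q))" if "v \<in> tangent_space T A p" for v i
        using \<theta>[OF p that, of i] cov_apply[OF pU that, of i Y]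
        unfolding dX[OF that] Y(1) jet_coord_jet1[OF Y(2) pU] jet_coord1_jet1[OF Y(2) pU]
        by (simp add: mult.commute)
      ultimately have "same_jet1 T A p X Y"
        using same_jet1_iff[OF lX Y(2) pU] by blast
      then show ?thesis
        using jet1_cong Y(1) by metis
    qed
    then show "\<exists>X. vector_field T A V X \<and> (\<forall>p\<in>V. s p = jet1 T A X p)"
      using X by blast
  next
    assume "\<exists>X. vector_field T A V X \<and> (\<forall>p\<in>V. s p = jet1 T A X p)"
    then obtain X where X: "vector_field T A V X" and sX: "\<And>p. p \<in> V \<Longrightarrow> s p = jet1 T A X p"
      by blast
    show "\<forall>i. vanishes_along T A V s (theta1 e \<omega> W i)"
      unfolding vanishes_along_def
    proof (intro allI ballI)
      fix i p v assume p: "p \<in> V" and v: "v \<in> tangent_space T A p"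
      have pU: "p \<in> U" using p V by auto
      have coord: "jet_coord \<omega> i (s q) = \<omega> i q (X q)" "jet_coord1 e \<omega> W i k (s q) = cov X i k q"
        if "q \<in> V" for q i k
        using that V(2) local_fieldI[OF V(1) that X] by (auto simp: sX jet_coord_jet1 jet_coord1_jet1)
      have "v (jet_coord \<omega> i \<circ> s) = v (\<lambda>q. \<omega> i q (X q))"
        using coord by (intro tangent_local[OF v V(1) p]) simp
      moreover have "theta1 e \<omega> W i (s p) (push_forward s v) = v (jet_coord \<omega> i \<circ> s)
          + (\<Sum>k\<in>UNIV. jet_coord \<omega> k (s p) * W i k p v)
          - (\<Sum>k\<in>UNIV. jet_coord1 e \<omega> W i k (s p) * \<omega> k p v)"
        by (rule theta1_section[OF V(1) p v]) (rule fst)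
      ultimately show "theta1 e \<omega> W i (s p) (push_forward s v) = 0"
        unfolding coord[OF p] cov_apply[OF pU v] by (simp add: mult.commute)
    qed
  qed
qed

section \<open>Operators that are linear in the first jet\<close>

text \<open>The coefficients are quantified before \<open>X\<close>, hence shared by all of
  \<open>S\<close>; restricting to \<open>S\<close> allows the solution's equations to be used when
  an operator is rewritten.\<close>

definition jet_linear :: "'a set \<Rightarrow> 'a vfield set \<Rightarrow> ('a vfield \<Rightarrow> 'a \<Rightarrow> real) \<Rightarrow> bool" where
  "jet_linear V S F \<longleftrightarrow> (\<exists>a b. (\<forall>m. smooth_fun A V (a m)) \<and> (\<forall>m r. smooth_fun A V (b m r)) \<and>
     (\<forall>X\<in>S. \<forall>p\<in>V. F X p = (\<Sum>m\<in>UNIV. a m p * \<omega> m p (X p)) +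
        (\<Sum>m\<in>UNIV. \<Sum>r\<in>UNIV. b m r p * e r p (\<lambda>q. \<omega> m q (X q)))))"

lemma jet_linear_cong:
  "(\<And>X p. X \<in> S \<Longrightarrow> p \<in> V \<Longrightarrow> F X p = G X p) \<Longrightarrow> jet_linear V S G \<Longrightarrow> jet_linear V S F"
  by (simp add: jet_linear_def cong: ball_cong)

lemma jet_linear_component: "jet_linear V S (\<lambda>X p. \<omega> m p (X p))"
  unfolding jet_linear_def
  by (rule exI[of _ "\<lambda>m' p. if m' = m then 1 else 0"], rule exI[of _ "\<lambda>m' r p. 0"])
    (simp add: smooth_fun_const if_zero_mult)

lemma jet_linear_derivative: "jet_linear V S (\<lambda>X p. e r p (\<lambda>q. \<omega> m q (X q)))"
  unfolding jet_linear_def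
  by (rule exI[of _ "\<lambda>m' p. 0"], rule exI[of _ "\<lambda>m' r' p. if m' = m then if r' = r then 1 else 0 else 0"])
    (simp add: smooth_fun_const if_zero_mult)

lemma jet_linear_add:
  assumes "openin T V" "jet_linear V S F" "jet_linear V S G"
  shows "jet_linear V S (\<lambda>X p. F X p + G X p)"
proof -
  obtain a b a' b' where
    "\<forall>m. smooth_fun A V (a m)" "\<forall>m r. smooth_fun A V (b m r)"
    "\<forall>m. smooth_fun A V (a' m)" "\<forall>m r. smooth_fun A V (b' m r)"
    "\<forall>X\<in>S. \<forall>p\<in>V. F X p = (\<Sum>m\<in>UNIV. a m p * \<omega> m p (X p)) +
        (\<Sum>m\<in>UNIV. \<Sum>r\<in>UNIV. b m r p * e r p (\<lambda>q. \<omega> m q (X q)))"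
    "\<forall>X\<in>S. \<forall>p\<in>V. G X p = (\<Sum>m\<in>UNIV. a' m p * \<omega> m p (X p)) +
        (\<Sum>m\<in>UNIV. \<Sum>r\<in>UNIV. b' m r p * e r p (\<lambda>q. \<omega> m q (X q)))"
    using assms(2,3) unfolding jet_linear_def by blast
  then show ?thesis
    unfolding jet_linear_def using smooth_fun_add[OF assms(1)]
    by (intro exI[of _ "\<lambda>m p. a m p + a' m p"] exI[of _ "\<lambda>m r p. b m r p + b' m r p"])
      (simp add: sum.distrib distrib_right)
qed

lemma jet_linear_mult:
  assumes "openin T V" "smooth_fun A V c" "jet_linear V S F"
  shows "jet_linear V S (\<lambda>X p. c p * F X p)"
proof -
  obtain a b where
    "\<forall>m. smooth_fun A V (a m)" "\<forall>m r. smooth_fun A V (b m r)"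
    "\<forall>X\<in>S. \<forall>p\<in>V. F X p = (\<Sum>m\<in>UNIV. a m p * \<omega> m p (X p)) +
        (\<Sum>m\<in>UNIV. \<Sum>r\<in>UNIV. b m r p * e r p (\<lambda>q. \<omega> m q (X q)))"
    using assms(3) unfolding jet_linear_def by blast
  then show ?thesis
    unfolding jet_linear_def using smooth_fun_mult[OF assms(1,2)]
    by (intro exI[of _ "\<lambda>m p. c p * a m p"] exI[of _ "\<lambda>m r p. c p * b m r p"])
      (simp add: distrib_left sum_distrib_left mult.assoc)
qed

lemma jet_linear_diff:
  assumes "openin T V" "jet_linear V S F" "jet_linear V S G"
  shows "jet_linear V S (\<lambda>X p. F X p - G X p)"
  using jet_linear_add[OF assms(1,2) jet_linear_mult[OF assms(1) smooth_fun_const[of V "-1"] assms(3)]]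
  by simp

lemma jet_linear_zero: "jet_linear V S (\<lambda>X p. 0)"
  unfolding jet_linear_def by (intro exI[of _ "\<lambda>_ _. 0"] exI[of _ "\<lambda>_ _ _. 0"]) (simp add: smooth_fun_const)

lemma jet_linear_sum:
  assumes "openin T V" "\<And>i. i \<in> I \<Longrightarrow> jet_linear V S (F i)"
  shows "jet_linear V S (\<lambda>X p. \<Sum>i\<in>I. F i X p)"
  using assms(2)
  by (induction I rule: infinite_finite_induct) (auto intro: jet_linear_zero jet_linear_add[OF assms(1)])

text \<open>It suffices to treat \<open>e l (e k ...)\<close> on components: this differs from the
  derivative of \<open>cov X i k\<close> by terms linear in the 1-jet, and \<open>second\<close>
  expresses the latter through the 1-jet.\<close>

lemma jet_linear_second_derivative:
  assumes V: "openin T V" "V \<subseteq> U" and Y: "vector_field T A V Y" and Z: "vector_field T A V Z"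
    and S: "\<And>X. X \<in> S \<Longrightarrow> vector_field T A V X"
    and second: "\<And>X p i j l. X \<in> S \<Longrightarrow> p \<in> V \<Longrightarrow>
      cov2 X i j l p + (\<Sum>k\<in>UNIV. \<omega> k p (X p) * R i j k l p) = 0"
  shows "jet_linear V S (\<lambda>X p. Y p (\<lambda>q. Z q (\<lambda>r. \<omega> i r (X r))))"
proof -
  note closure = jet_linear_add[OF V(1)] jet_linear_diff[OF V(1)] jet_linear_mult[OF V(1)]
    jet_linear_sum[OF V(1)] jet_linear_component jet_linear_derivative
  note smooth_W = W_smooth[OF V e_field[OF V(2)]]
  have smooth_dW: "smooth_fun A V (\<lambda>p. e l p (\<lambda>q. W i j q (e k q)))" for i j k l
    by (rule vector_field_smooth[OF e_field[OF V(2)] V(1) order_refl smooth_W])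
  have cov_linear: "jet_linear V S (\<lambda>X p. cov X i k p)" for i k
    unfolding cov_def using smooth_W by (subst mult.commute) (intro closure)
  have d_cov: "jet_linear V S (\<lambda>X p. e l p (cov X i k))" for i k l
  proof (rule jet_linear_cong)
    show "e l p (cov X i k) = (\<Sum>m\<in>UNIV. W m k p (e l p) * cov X i m p)
        - (\<Sum>m\<in>UNIV. W i m p (e l p) * cov X m k p) - (\<Sum>m\<in>UNIV. R i k m l p * \<omega> m p (X p))"
      if "X \<in> S" "p \<in> V" for X p
      using second[OF that, of i k l] by (simp add: cov2_def mult.commute)
    show "jet_linear V S (\<lambda>X p. (\<Sum>m\<in>UNIV. W m k p (e l p) * cov X i m p)
        - (\<Sum>m\<in>UNIV. W i m p (e l p) * cov X m k p) - (\<Sum>m\<in>UNIV. R i k m l p * \<omega> m p (X p)))"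
      by (intro closure smooth_W cov_linear smooth_fun_subset[OF R_smooth V(2)])
  qed
  have d_e: "jet_linear V S (\<lambda>X p. e l p (\<lambda>q. e k q (\<lambda>r. \<omega> i r (X r))))" for l k
  proof (rule jet_linear_cong)
    show "e l p (\<lambda>q. e k q (\<lambda>r. \<omega> i r (X r))) = e l p (cov X i k)
        - (\<Sum>m\<in>UNIV. W i m p (e k p) * e l p (\<lambda>q. \<omega> m q (X q))
          + e l p (\<lambda>q. W i m q (e k q)) * \<omega> m p (X p))"
      if "X \<in> S" "p \<in> V" for X p
    proof -
      have p: "p \<in> U" using that V by auto
      have near: "smooth_near T A p (\<lambda>q. \<omega> m q (X q))" for m
        using \<omega>_smooth[OF V S[OF that(1)]] smooth_nearI[OF V(1) that(2)] by auto
      have "e l p (cov X i k) = e l p (\<lambda>q. e k q (\<lambda>r. \<omega> i r (X r)))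
          + e l p (\<lambda>q. \<Sum>m\<in>UNIV. \<omega> m q (X q) * W i m q (e k q))"
        unfolding cov_def
        by (rule tangent_add[OF e_tangent[OF p]])
          (intro e_smooth_near[OF p] near smooth_near_sum U_topspace[OF p] smooth_near_mult W_e_smooth_near[OF p])+
      also have "e l p (\<lambda>q. \<Sum>m\<in>UNIV. \<omega> m q (X q) * W i m q (e k q)) =
          (\<Sum>m\<in>UNIV. e l p (\<lambda>q. \<omega> m q (X q)) * W i m p (e k p) + \<omega> m p (X p) * e l p (\<lambda>q. W i m q (e k q)))"
        by (rule tangent_sum_mult[OF e_tangent[OF p] U_topspace[OF p]]) (rule near W_e_smooth_near[OF p])+
      finally show ?thesis
        by (simp add: mult.commute)
    qed
    show "jet_linear V S (\<lambda>X p. e l p (cov X i k)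
        - (\<Sum>m\<in>UNIV. W i m p (e k p) * e l p (\<lambda>q. \<omega> m q (X q))
          + e l p (\<lambda>q. W i m q (e k q)) * \<omega> m p (X p)))"
      by (intro closure smooth_W smooth_dW d_cov)
  qed
  show ?thesis
  proof (rule jet_linear_cong)
    \<comment> \<open>\<open>Z\<close> and then \<open>Y\<close> are expanded in the frame; their
      components, and the derivatives of those of \<open>Z\<close>, act as smooth
      coefficients.\<close>
    show "Y p (\<lambda>q. Z q (\<lambda>r. \<omega> i r (X r))) =
        (\<Sum>k\<in>UNIV. Y p (\<lambda>q. \<omega> k q (Z q)) * e k p (\<lambda>r. \<omega> i r (X r))
          + \<omega> k p (Z p) * (\<Sum>l\<in>UNIV. \<omega> l p (Y p) * e l p (\<lambda>q. e k q (\<lambda>r. \<omega> i r (X r)))))"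
      if "X \<in> S" "p \<in> V" for X p
    proof -
      have p: "p \<in> U" using that V by auto
      have Yp: "Y p \<in> tangent_space T A p"
        using vector_field_tangent[OF Y that(2)] .
      have "smooth_near T A p (\<lambda>q. \<omega> i q (X q))"
        using \<omega>_smooth[OF V S[OF that(1)]] smooth_nearI[OF V(1) that(2)] by auto
      from field_derivative[OF local_fieldI[OF V(1) that(2) Z] p Yp this] show ?thesis
        by (simp add: tangent_apply[OF p Yp, of "\<lambda>q. e _ q _"])
    qed
    show "jet_linear V S (\<lambda>X p. \<Sum>k\<in>UNIV. Y p (\<lambda>q. \<omega> k q (Z q)) * e k p (\<lambda>r. \<omega> i r (X r))
          + \<omega> k p (Z p) * (\<Sum>l\<in>UNIV. \<omega> l p (Y p) * e l p (\<lambda>q. e k q (\<lambda>r. \<omega> i r (X r)))))"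
      by (intro closure d_e \<omega>_smooth[OF V] Y Z vector_field_smooth[OF Y V(1)] order_refl)
  qed
qed

section \<open>The prolongation\<close>

text \<open>Both the Killing equation and membership of the jets in \<open>skew_jets\<close> amount
  to skewness of \<open>cov\<close>, from which \<open>killing_second_derivative\<close> yields the
  equations of \<open>theta2\<close>.\<close>

lemma killing_field_iff_prolonged:
  assumes V: "openin T V" "V \<subseteq> U" and X: "vector_field T A V X"
  shows "killing_field T A g V X \<longleftrightarrow> (\<forall>p\<in>V. jet1 T A X p \<in> skew_jets T A U e \<omega> W) \<and>
    (\<forall>i j. vanishes_along T A V (jet1 T A X) (theta2 e \<omega> W R i j))"
  using killing_field_iff_skew[OF assms] jet1_in_skew_jets_iff[OF V _ X] vanishes_theta2_iff[OF assms]
    killing_second_derivative[OF V _ X] by auto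

lemma killing_prolongation:
  "completely_determined_prolongation T A U e \<omega> W (killing_field T A g)
    (skew_jets T A U e \<omega> W) (theta1 e \<omega> W) (theta2 e \<omega> W R)"
  unfolding completely_determined_prolongation_def
proof (intro allI impI conjI)
  fix V assume V: "openin T V \<and> V \<subseteq> U"
  show "(\<forall>i. vanishes_along T A V s (theta1 e \<omega> W i)) \<longleftrightarrow>
      (\<exists>X. vector_field T A V X \<and> (\<forall>p\<in>V. s p = jet1 T A X p))"
    if "jet_section T A e \<omega> W V s" for s
    using contact_iff_holonomic that V by blast
  show "killing_field T A g V X \<longleftrightarrow> (\<forall>p\<in>V. jet1 T A X p \<in> skew_jets T A U e \<omega> W) \<and>
      (\<forall>i j. vanishes_along T A V (jet1 T A X) (theta2 e \<omega> W R i j))"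
    if "vector_field T A V X" for X
    using killing_field_iff_prolonged that V by blast
  fix Y Z assume YZ: "vector_field T A V Y \<and> vector_field T A V Z"
  define S where "S = {X. vector_field T A V X \<and> (\<forall>p\<in>V. jet1 T A X p \<in> skew_jets T A U e \<omega> W) \<and>
    (\<forall>i j. vanishes_along T A V (jet1 T A X) (theta2 e \<omega> W R i j))}"
  have "jet_linear V S (\<lambda>X p. Y p (\<lambda>q. Z q (\<lambda>r. \<omega> i r (X r))))" for i
    using V YZ vanishes_theta2_iff by (intro jet_linear_second_derivative) (auto simp: S_def)
  \<comment> \<open>Naming the property as \<open>P\<close> isolates the choice of coefficient
    families over the index \<open>i\<close>.\<close>
  moreover define P where "P i a b \<longleftrightarrow> (\<forall>m. smooth_fun A V (a m)) \<and> (\<forall>m r. smooth_fun A V (b m r)) \<and>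
     (\<forall>X\<in>S. \<forall>p\<in>V. Y p (\<lambda>q. Z q (\<lambda>r. \<omega> i r (X r))) = (\<Sum>m\<in>UNIV. a m p * \<omega> m p (X p)) +
        (\<Sum>m\<in>UNIV. \<Sum>r\<in>UNIV. b m r p * e r p (\<lambda>q. \<omega> m q (X q))))" for i a b
  ultimately have "\<forall>i. \<exists>a b. P i a b"
    unfolding jet_linear_def by blast
  then obtain a b where "\<And>i. P i (a i) (b i)"
    by metis
  then show "\<exists>a b. (\<forall>i m. smooth_fun A V (a i m)) \<and> (\<forall>i m r. smooth_fun A V (b i m r)) \<and>
      (\<forall>X. vector_field T A V X \<and> (\<forall>p\<in>V. jet1 T A X p \<in> skew_jets T A U e \<omega> W) \<and>
          (\<forall>i j. vanishes_along T A V (jet1 T A X) (theta2 e \<omega> W R i j)) \<longrightarrow>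
        (\<forall>p\<in>V. \<forall>i. Y p (\<lambda>q. Z q (\<lambda>r. \<omega> i r (X r))) =
           (\<Sum>m\<in>UNIV. a i m p * \<omega> m p (X p)) +
           (\<Sum>m\<in>UNIV. \<Sum>r\<in>UNIV. b i m r p * e r p (\<lambda>q. \<omega> m q (X q)))))"
    unfolding S_def P_def by (intro exI[of _ a] exI[of _ b]) blast
qed

text \<open>Duality identifies \<open>\<xi>\<close> with the components of \<open>X\<close>, and
  evaluation on frame vectors identifies \<open>\<xi>'\<close> with \<open>cov\<close>. Both
  agreements hold on all of \<open>U\<close>, so they can be differentiated.\<close>

lemma killing_components:
  assumes K: "killing_field T A g U X"
    and X: "\<And>p. p \<in> U \<Longrightarrow> X p = (\<lambda>f. \<Sum>j\<in>UNIV. \<xi> j p * e j p f)"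
    and \<xi>': "\<And>p v i. p \<in> U \<Longrightarrow> v \<in> tangent_space T A p \<Longrightarrow>
      v (\<xi> i) + (\<Sum>k\<in>UNIV. \<xi> k p * W i k p v) = (\<Sum>k\<in>UNIV. \<xi>' i k p * \<omega> k p v)"
    and p: "p \<in> U"
  shows "\<xi>' j k p + \<xi>' k j p = 0"
    and "v \<in> tangent_space T A p \<Longrightarrow>
      v (\<xi>' i j) - (\<Sum>k\<in>UNIV. \<xi>' i k p * W k j p v) + (\<Sum>k\<in>UNIV. \<xi>' k j p * W i k p v)
        + (\<Sum>k\<in>UNIV. \<Sum>l\<in>UNIV. \<xi> k p * R i j k l p * \<omega> l p v) = 0"
proof -
  have field: "vector_field T A U X"
    using K by (simp add: killing_field_def)
  have comp: "\<omega> i q (X q) = \<xi> i q" if "q \<in> U" for i q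
    using \<omega>_sum_e[OF that] X[OF that] by simp
  have cov: "cov X i k q = \<xi>' i k q" if q: "q \<in> U" for i k q
  proof -
    have "e k q (\<lambda>q. \<omega> i q (X q)) = e k q (\<xi> i)"
      by (intro tangent_local[OF e_tangent[OF q] open_U q] comp)
    moreover have "(\<Sum>m\<in>UNIV. \<xi>' i m q * \<omega> m q (e k q)) = \<xi>' i k q"
      using q by (simp add: \<omega>_e if_zero_mult)
    ultimately show ?thesis
      using \<xi>'[OF q e_tangent[OF q], of k i] by (simp add: cov_def comp q)
  qed
  have skew: "cov X i k q + cov X k i q = 0" if "q \<in> U" for i k q
    using killing_field_iff_skew[OF open_U order_refl field] K that by blast
  then show "\<xi>' j k p + \<xi>' k j p = 0"
    using p by (simp add: cov)
  assume v: "v \<in> tangent_space T A p"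
  have "v (cov X i j) = v (\<xi>' i j)"
    by (intro tangent_local[OF v open_U p] cov)
  then show "v (\<xi>' i j) - (\<Sum>k\<in>UNIV. \<xi>' i k p * W k j p v) + (\<Sum>k\<in>UNIV. \<xi>' k j p * W i k p v)
        + (\<Sum>k\<in>UNIV. \<Sum>l\<in>UNIV. \<xi> k p * R i j k l p * \<omega> l p v) = 0"
    using theta2_expand[OF p v, of X i j] killing_second_derivative[OF open_U order_refl p field skew]
    by (simp add: cov comp p)
qed

end

theorem proposition2p1:
  fixes T :: "'a topology"
    and A :: "('a, 'n::finite) chart set"
    and g :: "'a \<Rightarrow> 'a functional \<Rightarrow> 'a functional \<Rightarrow> real"
    and U :: "'a set"
    and e :: "'n \<Rightarrow> 'a vfield"
    and \<omega> :: "'n \<Rightarrow> 'a form1"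
    and W :: "'n \<Rightarrow> 'n \<Rightarrow> 'a form1"
    and R :: "'n \<Rightarrow> 'n \<Rightarrow> 'n \<Rightarrow> 'n \<Rightarrow> 'a \<Rightarrow> real"
  assumes "smooth_manifold T A"
    and "riemannian_metric T A g"
    and "openin T U"
    and "orthonormal_frame T A g U e"
    and "dual_coframe T A U e \<omega>"
    and "connection_curvature T A U \<omega> W R"
  shows "completely_determined_prolongation T A U e \<omega> W (killing_field T A g)
           (skew_jets T A U e \<omega> W) (theta1 e \<omega> W) (theta2 e \<omega> W R) \<and>
         (\<forall>X (\<xi> :: 'n \<Rightarrow> 'a \<Rightarrow> real) (\<xi>' :: 'n \<Rightarrow> 'n \<Rightarrow> 'a \<Rightarrow> real).
            killing_field T A g U X \<and>
            (\<forall>p\<in>U. X p = (\<lambda>f. \<Sum>j\<in>UNIV. \<xi> j p * e j p f)) \<and>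
            (\<forall>p\<in>U. \<forall>v\<in>tangent_space T A p. \<forall>i.
               v (\<xi> i) + (\<Sum>k\<in>UNIV. \<xi> k p * W i k p v) = (\<Sum>k\<in>UNIV. \<xi>' i k p * \<omega> k p v)) \<longrightarrow>
            (\<forall>p\<in>U. \<forall>j k. \<xi>' j k p + \<xi>' k j p = 0) \<and>
            (\<forall>p\<in>U. \<forall>v\<in>tangent_space T A p. \<forall>i j.
               v (\<xi>' i j) - (\<Sum>k\<in>UNIV. \<xi>' i k p * W k j p v) + (\<Sum>k\<in>UNIV. \<xi>' k j p * W i k p v)
               + (\<Sum>k\<in>UNIV. \<Sum>l\<in>UNIV. \<xi> k p * R i j k l p * \<omega> l p v) = 0))"
proof -
  interpret framed_manifold T A g U e \<omega> W R
    using assms by unfold_locales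
  show ?thesis
  proof (intro conjI allI impI)
    fix X and \<xi> :: "'n \<Rightarrow> 'a \<Rightarrow> real" and \<xi>' :: "'n \<Rightarrow> 'n \<Rightarrow> 'a \<Rightarrow> real"
    assume "killing_field T A g U X \<and>
      (\<forall>p\<in>U. X p = (\<lambda>f. \<Sum>j\<in>UNIV. \<xi> j p * e j p f)) \<and>
      (\<forall>p\<in>U. \<forall>v\<in>tangent_space T A p. \<forall>i.
         v (\<xi> i) + (\<Sum>k\<in>UNIV. \<xi> k p * W i k p v) = (\<Sum>k\<in>UNIV. \<xi>' i k p * \<omega> k p v))"
    then have K: "killing_field T A g U X"
      "\<And>p. p \<in> U \<Longrightarrow> X p = (\<lambda>f. \<Sum>j\<in>UNIV. \<xi> j p * e j p f)"
      "\<And>p v i. p \<in> U \<Longrightarrow> v \<in> tangent_space T A p \<Longrightarrow>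
        v (\<xi> i) + (\<Sum>k\<in>UNIV. \<xi> k p * W i k p v) = (\<Sum>k\<in>UNIV. \<xi>' i k p * \<omega> k p v)"
      by blast+
    show "\<forall>p\<in>U. \<forall>j k. \<xi>' j k p + \<xi>' k j p = 0"
      using killing_components(1)[OF K] by blast
    show "\<forall>p\<in>U. \<forall>v\<in>tangent_space T A p. \<forall>i j.
        v (\<xi>' i j) - (\<Sum>k\<in>UNIV. \<xi>' i k p * W k j p v) + (\<Sum>k\<in>UNIV. \<xi>' k j p * W i k p v)
        + (\<Sum>k\<in>UNIV. \<Sum>l\<in>UNIV. \<xi> k p * R i j k l p * \<omega> l p v) = 0"
      using killing_components(2)[OF K] by blast
  qed (rule killing_prolongation)
qed

end
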